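(* Let $D$ be a (nonempty) link diagram. Then $$\chi_A(\langle\!\langle D\rangle\!\rangle)=(-A^{-2}-A^{2})\,\langle D\rangle,$$ that is, the graded Euler characteristic of $\langle\!\langle D\rangle\!\rangle$ equals the unnormalized Kauffman bracket of $D$.
   Context: A diagram is an unoriented planar link diagram. Graded abelian groups are $\mathbb Z$-graded, $G\{l\}$ is the shift $(G\{l\})_j=G_{j-l}$, and the graded dimension is $q\dim G=\sum_j A^j\operatorname{rk}G_j$. For a $2$-complex $(G_0,G_1,\partial_0,\partial_1)$ (graded abelian groups with degree-$0$ maps $\partial_0:G_0\to G_1$, $\partial_1:G_1\to G_0$, both composites zero) the graded Euler characteristic is $\chi_A=q\dim G_0-q\dim G_1\in\mathbb Z[A,A^{-1}]$; it depends only on the groups $G_0,G_1$. Let $W$ be the free graded abelian group with basis $w_+$ in degree $2$ and $w_-$ in degree $-2$. A Kauffman state $s$ of $D$ marks each crossing with $A$ (or $0$) or $B$ (or $1$). Splitting each crossing according to its mark (the $A$-splitting joins the two regions swept by the overcrossing strand when rotated counterclockwise towards the undercrossing strand, the $B$-splitting joins the other two) gives a collection $D_s$ of $|s|$ disjoint circles. $a(s)$, $b(s)$ are the numbers of crossings marked $A$, $B$; $s_A$ is the state with all marks $A$. The Kauffman bracket of a nonempty diagram is $\langle D\rangle=\sum_s A^{a(s)-b(s)}(-A^2-A^{-2})^{|s|-1}$. Put $W_s(D)=\big(\bigotimes_{\text{circles of }D_s}W\big)\{a(s)-b(s)\}$. The $2$-complex $\langle\!\langle D\rangle\!\rangle$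 has underlying graded groups, for $i\in\{0,1\}$, $$\langle\!\langle D\rangle\!\rangle_i=\bigoplus_{s:\ b(s)+|s_A|\in 2\mathbb Z+i}W_s(D).$$ Its differentials (not needed for this statement) are signed sums, over pairs of states differing at one crossing by changing $A$ to $B$, of maps induced by the merge map $W\otimes W\to W$ and the split map $W\to W\otimes W$ obtained from Khovanov's $m,\Delta$ by replacing $v_+$ with $w_-$ and $v_-$ with $w_+$. *)

theory Defs
  imports "HOL-Algebra.Algebra" "HOL-Library.Poly_Mapping"
begin

section \<open>Graded abelian groups\<close>

text \<open>A graded abelian group is the family of its homogeneous components; it is required to be a
  family of commutative groups only where that matters.  Groups are written multiplicatively,
  following HOL-Algebra.\<close>

type_synonym 'a graded_group = "int \<Rightarrow> 'a monoid"

definition shift :: "'a graded_group \<Rightarrow> int \<Rightarrow> 'a graded_group" where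
  "shift G l = (\<lambda>j. G (j - l))"

definition direct_sum :: "'i set \<Rightarrow> ('i \<Rightarrow> 'a graded_group) \<Rightarrow> ('i \<Rightarrow> 'a) graded_group" where
  "direct_sum I G = (\<lambda>j. sum_group I (\<lambda>i. G i j))"

text \<open>The tensor product over the integers of a finite, unordered family of abelian groups: the free
  abelian group on all families \<open>f\<close> of elements (the pure tensors), modulo additivity in each
  factor.  For an empty index set this is infinite cyclic, with generator the empty tensor.\<close>

definition multilinear_relations ::
    "'i set \<Rightarrow> ('i \<Rightarrow> 'a monoid) \<Rightarrow> (('i \<Rightarrow> 'a) \<Rightarrow>\<^sub>0 int) set" where
  "multilinear_relations I G =
     {frag_of (f(i := x \<otimes>\<^bsub>G i\<^esub> y)) - frag_of (f(i := x)) - frag_of (f(i := y)) | f i x y.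
        f \<in> (\<Pi>\<^sub>E k\<in>I. carrier (G k)) \<and> i \<in> I \<and> x \<in> carrier (G i) \<and> y \<in> carrier (G i)}"

definition tensor_group ::
    "'i set \<Rightarrow> ('i \<Rightarrow> 'a monoid) \<Rightarrow> (('i \<Rightarrow> 'a) \<Rightarrow>\<^sub>0 int) set monoid" where
  "tensor_group I G =
     (let F = free_Abelian_group (\<Pi>\<^sub>E i\<in>I. carrier (G i))
      in F Mod generate F (multilinear_relations I G))"

text \<open>In degree \<open>n\<close>, the graded tensor product is the direct sum, over all multidegrees \<open>d\<close> of total
  degree \<open>n\<close>, of the tensor products of the components of degrees \<open>d i\<close>.\<close>

definition graded_tensor ::
    "'i set \<Rightarrow> ('i \<Rightarrow> 'a graded_group) \<Rightarrow> (('i \<Rightarrow> int) \<Rightarrow> (('i \<Rightarrow> 'a) \<Rightarrow>\<^sub>0 int) set) graded_group" where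
  "graded_tensor I G = (\<lambda>n.
     sum_group {d \<in> I \<rightarrow>\<^sub>E UNIV. (\<Sum>i\<in>I. d i) = n} (\<lambda>d. tensor_group I (\<lambda>i. G i (d i))))"

definition int_independent :: "'a monoid \<Rightarrow> 'a set \<Rightarrow> bool" where
  "int_independent G S \<longleftrightarrow> S \<subseteq> carrier G \<and>
     (\<forall>T c. finite T \<longrightarrow> T \<subseteq> S \<longrightarrow> finprod G (\<lambda>x. x [^]\<^bsub>G\<^esub> (c x :: int)) T = \<one>\<^bsub>G\<^esub>
        \<longrightarrow> (\<forall>x\<in>T. c x = 0))"

text \<open>Meaningful for abelian groups of finite rank.\<close>

definition rk :: "'a monoid \<Rightarrow> nat" where
  "rk G = Sup {card S | S. finite S \<and> int_independent G S}"

text \<open>Laurent polynomials are the group ring of the integers: finitely supported maps from exponents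
  to coefficients, multiplied by convolution.\<close>

type_synonym laurent = "int \<Rightarrow>\<^sub>0 int"

definition A_pow :: "int \<Rightarrow> laurent" where
  "A_pow k = Poly_Mapping.single k 1"

text \<open>Meaningful if only finitely many components have nonzero rank.\<close>

definition qdim :: "'a graded_group \<Rightarrow> laurent" where
  "qdim G = (\<Sum>j\<in>{j. rk (G j) \<noteq> 0}. of_nat (rk (G j)) * A_pow j)"

text \<open>The graded Euler characteristic of a 2-complex; only its two groups enter.\<close>

definition chi_A :: "'a graded_group \<Rightarrow> 'a graded_group \<Rightarrow> laurent" where
  "chi_A G0 G1 = qdim G0 - qdim G1"

datatype W_basis = w_plus | w_minus

fun W_deg :: "W_basis \<Rightarrow> int" where
  "W_deg w_plus = 2"
| "W_deg w_minus = - 2"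

definition W :: "(W_basis \<Rightarrow>\<^sub>0 int) graded_group" where
  "W = (\<lambda>j. free_Abelian_group {w. W_deg w = j})"


section \<open>Link diagrams\<close>

text \<open>A diagram is given by its planar-diagram code.  Around a crossing \<open>c\<close> there are four half-edges
  \<open>(c, 0)\<close>, \<open>(c, 1)\<close>, \<open>(c, 2)\<close>, \<open>(c, 3)\<close> in counterclockwise order; \<open>(c, 0)\<close> and \<open>(c, 2)\<close> form the
  undercrossing strand, \<open>(c, 1)\<close> and \<open>(c, 3)\<close> the overcrossing strand.  The map \<open>opp\<close> sends a
  half-edge to the other half of its edge.  The components of the diagram without crossings are
  simple closed curves, of which only the number is recorded.  Which region of one connected piece
  of the diagram contains another piece is not recorded either: it affects neither the circles of a
  state as a set nor anything built from them.\<close>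

type_synonym 'c half_edge = "'c \<times> nat"

record 'c diagram =
  crossings :: "'c set"
  opp :: "'c half_edge \<Rightarrow> 'c half_edge"
  loops :: nat

definition half_edges :: "'c diagram \<Rightarrow> 'c half_edge set" where
  "half_edges D = crossings D \<times> {..<4}"

definition rot :: "'c half_edge \<Rightarrow> 'c half_edge" where
  "rot h = (fst h, (snd h + 1) mod 4)"

text \<open>Classes of half-edges under the equivalence relation generated by \<open>h \<sim> f h\<close> for \<open>f \<in> F\<close>.\<close>

definition gen_classes ::
    "'c diagram \<Rightarrow> ('c half_edge \<Rightarrow> 'c half_edge) set \<Rightarrow> 'c half_edge set set" where
  "gen_classes D F =
     (let r = {(h, f h) | h f. h \<in> half_edges D \<and> f \<in> F}
      in half_edges D // {(x, y). x \<in> half_edges D \<and> y \<in> half_edges D \<and> (x, y) \<in> (r \<union> converse r)\<^sup>*})"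

definition edges :: "'c diagram \<Rightarrow> 'c half_edge set set" where
  "edges D = gen_classes D {opp D}"

text \<open>Going along an edge and turning to the next half-edge at its far end runs around a face of the
  4-valent graph underlying the diagram.\<close>

definition faces :: "'c diagram \<Rightarrow> 'c half_edge set set" where
  "faces D = gen_classes D {rot \<circ> opp D}"

definition components :: "'c diagram \<Rightarrow> 'c half_edge set set" where
  "components D = gen_classes D {rot, opp D}"

text \<open>Planarity is Euler's formula.  With \<open>faces\<close> counted separately for each connected component of
  the underlying graph, a component of genus \<open>g\<close> contributes \<open>2 - 2 g\<close> to the left-hand side, so
  the equation says that every component is drawn on a sphere, hence in the plane.\<close>

definition link_diagram :: "'c diagram \<Rightarrow> bool" where
  "link_diagram D \<longleftrightarrow>
     finite (crossings D) \<and>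
     (\<forall>h\<in>half_edges D. opp D h \<in> half_edges D \<and> opp D h \<noteq> h \<and> opp D (opp D h) = h) \<and>
     int (card (crossings D)) - int (card (edges D)) + int (card (faces D))
       = 2 * int (card (components D))"

definition nonempty_diagram :: "'c diagram \<Rightarrow> bool" where
  "nonempty_diagram D \<longleftrightarrow> crossings D \<noteq> {} \<or> loops D > 0"


section \<open>Kauffman states and the bracket\<close>

datatype mark = A_mark | B_mark

definition states :: "'c diagram \<Rightarrow> ('c \<Rightarrow> mark) set" where
  "states D = crossings D \<rightarrow>\<^sub>E UNIV"

definition state_A :: "'c diagram \<Rightarrow> 'c \<Rightarrow> mark" where
  "state_A D = (\<lambda>c\<in>crossings D. A_mark)"

definition a_count :: "'c diagram \<Rightarrow> ('c \<Rightarrow> mark) \<Rightarrow> nat" where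
  "a_count D s = card {c \<in> crossings D. s c = A_mark}"

definition b_count :: "'c diagram \<Rightarrow> ('c \<Rightarrow> mark) \<Rightarrow> nat" where
  "b_count D s = card {c \<in> crossings D. s c = B_mark}"

text \<open>Rotated counterclockwise, the overcrossing half-edges 1 and 3 sweep the corners between 1 and 2
  and between 3 and 0.  Joining these two corners (the \<open>A\<close>-splitting) leaves the arcs 0-1 and 2-3;
  joining the other two (the \<open>B\<close>-splitting) leaves the arcs 1-2 and 3-0.\<close>

definition smoothing :: "('c \<Rightarrow> mark) \<Rightarrow> 'c half_edge \<Rightarrow> 'c half_edge" where
  "smoothing s h = (case h of (c, k) \<Rightarrow>
     (c, case s c of
           A_mark \<Rightarrow> (if even k then k + 1 else k - 1)
         | B_mark \<Rightarrow> (if even k then (k + 3) mod 4 else (k + 1) mod 4)))"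

text \<open>A circle of \<open>D\<^sub>s\<close> is given by the half-edges it runs through, or is one of the closed curves
  without crossings.\<close>

definition circles :: "'c diagram \<Rightarrow> ('c \<Rightarrow> mark) \<Rightarrow> ('c half_edge set + nat) set" where
  "circles D s = Sum_Type.Plus (gen_classes D {opp D, smoothing s}) {..<loops D}"

definition kauffman_bracket :: "'c diagram \<Rightarrow> laurent" where
  "kauffman_bracket D =
     (\<Sum>s\<in>states D. A_pow (int (a_count D s) - int (b_count D s))
        * (- A_pow 2 - A_pow (- 2)) ^ (card (circles D s) - 1))"


section \<open>The groups of the 2-complex of a diagram\<close>

definition W_state ::
    "'c diagram \<Rightarrow> ('c \<Rightarrow> mark) \<Rightarrow>
      (('c half_edge set + nat \<Rightarrow> int) \<Rightarrow>
        (('c half_edge set + nat \<Rightarrow> W_basis \<Rightarrow>\<^sub>0 int) \<Rightarrow>\<^sub>0 int) set) graded_group" where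
  "W_state D s = shift (graded_tensor (circles D s) (\<lambda>_. W)) (int (a_count D s) - int (b_count D s))"

definition bracket_complex ::
    "'c diagram \<Rightarrow> nat \<Rightarrow>
      (('c \<Rightarrow> mark) \<Rightarrow> ('c half_edge set + nat \<Rightarrow> int) \<Rightarrow>
        (('c half_edge set + nat \<Rightarrow> W_basis \<Rightarrow>\<^sub>0 int) \<Rightarrow>\<^sub>0 int) set) graded_group" where
  "bracket_complex D i =
     direct_sum {s \<in> states D. (b_count D s + card (circles D (state_A D))) mod 2 = i} (W_state D)"

end

theory Submission
  imports Defs "HOL-Combinatorics.Orbits"
begin

text \<open>The component of degree \<open>j\<close> of the complex is free on the pairs of a state \<open>s\<close> of the right parity
  and a labelling of its circles by \<open>w\<^sub>+\<close> and \<open>w\<^sub>-\<close> of total degree \<open>j\<close>, so its graded dimension is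
  the sum of \<open>A\<^bsup>a(s)-b(s)\<^esup> (A\<^sup>2 + A\<^bsup>-2\<^esup>)\<^bsup>|s|\<^esup>\<close>.  What remains is the sign: \<open>|s|\<close> and \<open>b(s) + |s\<^sub>A|\<close> have the
  same parity.  This is where planarity enters.  Euler's formula makes every cocycle of the diagram
  modulo 2 a coboundary, which gives a checkerboard colouring of the faces, that is, a 2-colouring of
  the half-edges exchanged by every edge and every smoothing.  The circles of \<open>s\<close> are then the cycles
  of a permutation of one colour class, and changing one mark composes it with a transposition.\<close>

section \<open>Ranks of tensor products and direct sums of free abelian groups\<close>

text \<open>Parity is a global matter: on a torus, one crossing whose edges join half-edge 0 to 2
  and 1 to 3 has a single circle in both states, so a change of mark need not change the parity of
  the number of circles. A diagram is a combinatorial code and planarity one numerical equation; it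
  becomes the vanishing of the first cohomology modulo 2 by comparing cardinalities of finite vector
  spaces. The class that has to vanish records the edges whose two halves sit at positions of equal
  parity. Passing to permutations avoids any case distinction between merging and splitting circles,
  since the sign and the number of points fix the parity of the number of cycles. On the algebraic
  side, \<open>tensor_group\<close> is a quotient of a huge free group by relations, so a basis has
  to be exhibited before a rank can be read off.\<close>

lemma tensor_group_group:
  assumes "\<And>i. i \<in> I \<Longrightarrow> monoid (G i)"
  shows "group (tensor_group I G)"
proof -
  let ?F = "free_Abelian_group (\<Pi>\<^sub>E i\<in>I. carrier (G i))"
  interpret F: comm_group ?F
    by (rule abelian_free_Abelian_group)
  have "multilinear_relations I G \<subseteq> carrier ?F"
  proof
    fix z assume "z \<in> multilinear_relations I G"
    then obtain f i x y where z: "z = frag_of (f(i := x \<otimes>\<^bsub>G i\<^esub> y)) - frag_of (f(i := x)) - frag_of (f(i := y))"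
      and f: "f \<in> (\<Pi>\<^sub>E k\<in>I. carrier (G k))" "i \<in> I" "x \<in> carrier (G i)" "y \<in> carrier (G i)"
      unfolding multilinear_relations_def by blast
    have "f(i := u) \<in> (\<Pi>\<^sub>E k\<in>I. carrier (G k))" if "u \<in> carrier (G i)" for u
      using f that by (auto simp: PiE_iff extensional_def)
    moreover have "x \<otimes>\<^bsub>G i\<^esub> y \<in> carrier (G i)"
      using f assms by (simp add: monoid.m_closed)
    ultimately show "z \<in> carrier ?F"
      unfolding z carrier_free_Abelian_group_iff using f
      by (intro order_trans[OF keys_diff] Un_least) (simp_all add: keys_frag_of)
  qed
  then have "subgroup (generate ?F (multilinear_relations I G)) ?F"
    by (rule F.generate_is_subgroup)
  then show ?thesis
    unfolding tensor_group_def Let_def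
    by (intro comm_group.axioms(2) F.abelian_FactGroup)
qed

text \<open>\<open>\<psi>\<close> expands pure tensors in coordinates and \<open>\<theta>\<close>
  sends a family of basis elements back to its pure tensor. Since \<open>\<psi>\<close> after
  \<open>\<theta>\<close> is the identity and \<open>\<theta>\<close> after \<open>\<psi>\<close> is
  the identity modulo the relations, the kernel of \<open>\<psi>\<close> is exactly
  \<open>N\<close>, and the isomorphism theorem applies.\<close>

lemma tensor_group_free_iso:
  fixes B :: "'i \<Rightarrow> 'b set"
  assumes finI: "finite I" and finB: "\<And>i. i \<in> I \<Longrightarrow> finite (B i)"
  shows "tensor_group I (\<lambda>i. free_Abelian_group (B i)) \<cong> free_Abelian_group (Pi\<^sub>E I B)"
proof -
  let ?G = "\<lambda>i. free_Abelian_group (B i)"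
  define P where "P = (\<Pi>\<^sub>E i\<in>I. carrier (?G i))"
  define F where "F = free_Abelian_group P"
  define H where "H = free_Abelian_group (Pi\<^sub>E I B)"
  define R where "R = multilinear_relations I ?G"
  define N where "N = generate F R"
  define t where "t = (\<lambda>f. \<Sum>b\<in>Pi\<^sub>E I B. frag_cmul (\<Prod>i\<in>I. Poly_Mapping.lookup (f i) (b i)) (frag_of b))"
  define \<psi> where "\<psi> = frag_extend t"
  define \<theta> where "\<theta> = frag_extend (\<lambda>b :: 'i \<Rightarrow> 'b. frag_of (\<lambda>i\<in>I. frag_of (b i)))"
  interpret F: comm_group F
    unfolding F_def by (rule abelian_free_Abelian_group)
  interpret H: comm_group H
    unfolding H_def by (rule abelian_free_Abelian_group)
  have finPiE: "finite (Pi\<^sub>E I B)"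
    by (rule finite_PiE[OF finI finB])
  have P_upd: "f(i := x) \<in> P" if "f \<in> P" "i \<in> I" "Poly_Mapping.keys x \<subseteq> B i" for f i x
    using that by (auto simp: P_def PiE_iff extensional_def)
  have t_add: "t (f(i := x + y)) = t (f(i := x)) + t (f(i := y))" if "i \<in> I" for f i x y
  proof -
    have "(\<Prod>k\<in>I. Poly_Mapping.lookup ((f(i := z)) k) (b k)) =
        Poly_Mapping.lookup z (b i) * (\<Prod>k\<in>I - {i}. Poly_Mapping.lookup (f k) (b k))" for z b
      by (subst prod.remove[OF finI that]) (auto intro!: prod.cong)
    then show ?thesis
      by (simp add: t_def lookup_add frag_cmul_distrib algebra_simps sum.distrib)
  qed
  have t_basis: "t (\<lambda>i\<in>I. frag_of (b i)) = frag_of b" if "b \<in> Pi\<^sub>E I B" for b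
  proof -
    have "(\<Prod>i\<in>I. Poly_Mapping.lookup ((\<lambda>i\<in>I. frag_of (b i)) i) (b' i)) = (if b' = b then 1 else 0)"
      if b': "b' \<in> Pi\<^sub>E I B" for b'
    proof (cases "b' = b")
      case False
      then obtain i where "i \<in> I" "b' i \<noteq> b i"
        using PiE_ext[OF b' \<open>b \<in> Pi\<^sub>E I B\<close>] by blast
      then show ?thesis
        using finI False by auto
    qed auto
    then have "t (\<lambda>i\<in>I. frag_of (b i)) = (\<Sum>b'\<in>Pi\<^sub>E I B. if b' = b then frag_of b else 0)"
      unfolding t_def by (intro sum.cong) auto
    then show ?thesis
      using that finPiE by simp
  qed
  have R_mem: "frag_of (f(i := x + y)) - frag_of (f(i := x)) - frag_of (f(i := y)) \<in> R"
    if "f \<in> P" "i \<in> I" "Poly_Mapping.keys x \<subseteq> B i" "Poly_Mapping.keys y \<subseteq> B i" for f i x y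
    unfolding R_def multilinear_relations_def mem_Collect_eq
    using that by (intro exI[of _ f] exI[of _ i] exI[of _ x] exI[of _ y]) (auto simp: P_def)
  have R_elim: "\<exists>f i x y. z = frag_of (f(i := x + y)) - frag_of (f(i := x)) - frag_of (f(i := y))
      \<and> f \<in> P \<and> i \<in> I \<and> Poly_Mapping.keys x \<subseteq> B i \<and> Poly_Mapping.keys y \<subseteq> B i" if "z \<in> R" for z
    using that unfolding R_def multilinear_relations_def P_def by auto
  have keys_add': "Poly_Mapping.keys (x + y) \<subseteq> S"
    if "Poly_Mapping.keys x \<subseteq> S" "Poly_Mapping.keys y \<subseteq> S" for x y :: "'x \<Rightarrow>\<^sub>0 int" and S
    using that Poly_Mapping.keys_add[of x y] by blast
  have R_carrier: "R \<subseteq> carrier F"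
  proof
    fix z assume "z \<in> R"
    then obtain f i x y where z: "z = frag_of (f(i := x + y)) - frag_of (f(i := x)) - frag_of (f(i := y))"
      and f: "f \<in> P" "i \<in> I" "Poly_Mapping.keys x \<subseteq> B i" "Poly_Mapping.keys y \<subseteq> B i"
      using R_elim by blast
    have "f(i := x + y) \<in> P" "f(i := x) \<in> P" "f(i := y) \<in> P"
      using P_upd[OF f(1,2)] f(3,4) keys_add'[OF f(3,4)] by blast+
    then show "z \<in> carrier F"
      unfolding z F_def carrier_free_Abelian_group_iff
      by (intro order_trans[OF keys_diff] Un_least) (simp_all add: keys_frag_of)
  qed
  have N: "subgroup N F"
    unfolding N_def by (rule F.generate_is_subgroup[OF R_carrier])
  have N0: "0 \<in> N"
    using subgroup.one_closed[OF N] by (simp add: F_def)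
  have N_add: "x + y \<in> N" if "x \<in> N" "y \<in> N" for x y
    using subgroup.m_closed[OF N that] by (simp add: F_def)
  have N_minus: "- x \<in> N" if "x \<in> N" for x
    using subgroup.m_inv_closed[OF N that] subgroup.mem_carrier[OF N that] by (simp add: F_def)
  have N_diff: "x - y \<in> N" if "x \<in> N" "y \<in> N" for x y
    using N_add[OF that(1) N_minus[OF that(2)]] by simp
  have t_closed: "Poly_Mapping.keys (t f) \<subseteq> Pi\<^sub>E I B" for f
  proof -
    have "t f \<in> carrier H"
      unfolding t_def H_def by (rule sum_closed_free_Abelian_group) (auto simp: keys_frag_of)
    then show ?thesis by (simp add: H_def)
  qed
  have hom: "\<psi> \<in> hom F H"
  proof (rule homI)
    show "\<psi> x \<in> carrier H" for x
      unfolding H_def \<psi>_def carrier_free_Abelian_group_iff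
      using t_closed keys_frag_extend[of t x] by blast
  qed (simp add: F_def H_def \<psi>_def frag_extend_add)
  interpret \<psi>: group_hom F H \<psi>
    by unfold_locales (rule hom)
  have "R \<subseteq> kernel F H \<psi>"
    unfolding kernel_def
  proof (clarify, intro conjI)
    fix z assume "z \<in> R"
    then show "z \<in> carrier F" using R_carrier by blast
    obtain f i x y where z: "z = frag_of (f(i := x + y)) - frag_of (f(i := x)) - frag_of (f(i := y))"
      and f: "i \<in> I"
      using R_elim[OF \<open>z \<in> R\<close>] by blast
    show "\<psi> z = \<one>\<^bsub>H\<^esub>"
      unfolding z \<psi>_def by (simp add: frag_extend_diff t_add[OF f] H_def)
  qed
  then have N_ker: "N \<subseteq> kernel F H \<psi>"
    unfolding N_def by (rule F.generate_subgroup_incl[OF _ \<psi>.subgroup_kernel])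
  \<comment> \<open>Coordinates are expanded in the bases one at a time; \<open>J\<close> is the set of those not yet expanded.\<close>
  have pure: "frag_of f - \<theta> (t f) \<in> N"
    if "finite J" "J \<subseteq> I" "f \<in> P" "\<forall>i\<in>I - J. \<exists>b\<in>B i. f i = frag_of b" for J f
    using that
  proof (induction J arbitrary: f rule: finite_induct)
    case empty
    then obtain b where b: "\<And>i. i \<in> I \<Longrightarrow> b i \<in> B i \<and> f i = frag_of (b i)"
      by (metis Diff_empty)
    have f: "f = (\<lambda>i\<in>I. frag_of (restrict b I i))"
      using empty(2) b by (auto simp: P_def PiE_iff extensional_def)
    have "t f = frag_of (restrict b I)"
      unfolding f using t_basis[of "restrict b I"] b by simp
    moreover have "\<theta> (frag_of (restrict b I)) = frag_of f"
      unfolding \<theta>_def f by simp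
    ultimately show ?case
      using N0 by simp
  next
    case (insert i J)
    \<comment> \<open>\<open>E x\<close> is the error of the expansion when coordinate
      \<open>i\<close> is \<open>x\<close>. It is additive in \<open>x\<close> modulo
      \<open>N\<close>, so basis elements suffice, and for those coordinate \<open>i\<close> counts
      as expanded.\<close>
    define E where "E x = frag_of (f(i := x)) - \<theta> (t (f(i := x)))" for x
    have i: "i \<in> I" using insert by simp
    have E_add: "E (x + y) - E x - E y \<in> N"
      if "Poly_Mapping.keys x \<subseteq> B i" "Poly_Mapping.keys y \<subseteq> B i" for x y
    proof -
      have "E (x + y) - E x - E y = frag_of (f(i := x + y)) - frag_of (f(i := x)) - frag_of (f(i := y))"
        unfolding E_def t_add[OF i] by (simp add: \<theta>_def frag_extend_add)
      then show ?thesis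
        using R_mem[OF insert.prems(2) i that] unfolding N_def by (simp add: generate.incl)
    qed
    have "Poly_Mapping.keys (f i) \<subseteq> B i"
      using insert.prems i by (auto simp: P_def PiE_iff)
    then have "E (f i) \<in> N"
    proof (induction rule: free_Abelian_group_induct[consumes 1, case_names zero diff basis])
      case zero
      show ?case
        using N_minus[OF E_add[of 0 0]] by simp
    next
      case (diff x y)
      have "Poly_Mapping.keys (x - y) \<subseteq> B i"
        using diff keys_diff[of x y] by blast
      with diff have "E x - E (x - y) - E y \<in> N"
        using E_add[of "x - y" y] by simp
      then have "E x - E y - (E x - E (x - y) - E y) \<in> N"
        using N_diff[OF N_diff[OF diff(3,4)]] by blast
      moreover have "E x - E y - (E x - E (x - y) - E y) = E (x - y)"
        by (simp add: algebra_simps)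
      ultimately show ?case by simp
    next
      case (basis b)
      show ?case
        unfolding E_def using insert.prems i basis
        by (intro insert.IH P_upd) (auto simp: keys_frag_of)
    qed
    then show ?case by (simp add: E_def)
  qed
  have proj: "x - \<theta> (\<psi> x) \<in> N" if "Poly_Mapping.keys x \<subseteq> P" for x
    using that
  proof (induction rule: free_Abelian_group_induct[consumes 1, case_names zero diff basis])
    case zero
    then show ?case using N0 by (simp add: \<theta>_def \<psi>_def)
  next
    case (diff x y)
    then have "(x - \<theta> (\<psi> x)) - (y - \<theta> (\<psi> y)) \<in> N"
      using N_diff by blast
    then show ?case by (simp add: \<theta>_def \<psi>_def frag_extend_diff algebra_simps)
  next
    case (basis f)
    then show ?case using pure[OF finI, of f] by (simp add: \<psi>_def)
  qed
  have ker: "kernel F H \<psi> = N"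
  proof
    show "kernel F H \<psi> \<subseteq> N"
    proof
      fix x assume "x \<in> kernel F H \<psi>"
      then have "Poly_Mapping.keys x \<subseteq> P" "\<psi> x = 0"
        by (simp_all add: kernel_def F_def H_def)
      then show "x \<in> N"
        using proj[of x] by (simp add: \<theta>_def)
    qed
  qed (rule N_ker)
  have "\<psi> ` carrier F = carrier H"
  proof
    show "carrier H \<subseteq> \<psi> ` carrier F"
    proof
      fix y assume "y \<in> carrier H"
      then have y: "Poly_Mapping.keys y \<subseteq> Pi\<^sub>E I B" by (simp add: H_def)
      have "(\<lambda>i\<in>I. frag_of (b i)) \<in> P" if "b \<in> Pi\<^sub>E I B" for b
        using that by (auto simp: P_def keys_frag_of)
      then have "Poly_Mapping.keys (\<theta> y) \<subseteq> P"
        using keys_frag_extend[of "\<lambda>b. frag_of (\<lambda>i\<in>I. frag_of (b i))" y] y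
        unfolding \<theta>_def by (fastforce simp: keys_frag_of)
      moreover have "\<psi> (\<theta> y) = y"
        using y
      proof (induction rule: free_Abelian_group_induct[consumes 1, case_names zero diff basis])
        case (basis b)
        then show ?case using t_basis by (simp add: \<theta>_def \<psi>_def)
      qed (simp_all add: \<theta>_def \<psi>_def frag_extend_diff)
      ultimately show "y \<in> \<psi> ` carrier F"
        by (metis F_def carrier_free_Abelian_group_iff image_eqI)
    qed
  qed (use hom in \<open>auto simp: hom_def\<close>)
  then show ?thesis
    using \<psi>.FactGroup_iso ker
    unfolding tensor_group_def N_def R_def F_def H_def P_def Let_def by simp
qed

text \<open>Gaussian elimination over the integers. The unknown \<open>u\<close> is eliminated by
  cross-multiplication instead of division, which keeps all coefficients integral; non-triviality
  survives because the smaller solution is scaled by the nonzero pivot \<open>a u s\<close>.\<close>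

lemma homogeneous_system_nontrivial_solution:
  fixes a :: "'t \<Rightarrow> 's \<Rightarrow> int"
  assumes "finite S" and "finite T" and "card S < card T"
  shows "\<exists>c. (\<exists>t\<in>T. c t \<noteq> 0) \<and> (\<forall>s\<in>S. (\<Sum>t\<in>T. c t * a t s) = 0)"
  using assms
proof (induction S arbitrary: T a rule: finite_induct)
  case empty
  then obtain t where "t \<in> T" by fastforce
  then show ?case by (intro exI[of _ "\<lambda>_. 1"]) auto
next
  case (insert s S)
  show ?case
  proof (cases "\<forall>t\<in>T. a t s = 0")
    case True
    have "card S < card T"
      using insert by simp
    from insert.IH[OF insert.prems(1) this, of a] True show ?thesis
      by auto
  next
    case False
    then obtain u where u: "u \<in> T" "a u s \<noteq> 0" by blast
    define T' where "T' = T - {u}"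
    have "card S < card T'" "finite T'"
      using insert u by (auto simp: T'_def)
    from insert.IH[OF this(2,1), of "\<lambda>t s'. a u s * a t s' - a t s * a u s'"]
    obtain c where c: "\<exists>t\<in>T'. c t \<noteq> 0"
      and eq: "\<And>s'. s' \<in> S \<Longrightarrow> (\<Sum>t\<in>T'. c t * (a u s * a t s' - a t s * a u s')) = 0"
      by blast
    define d where "d t = (if t = u then - (\<Sum>t\<in>T'. c t * a t s) else a u s * c t)" for t
    have sum_d: "(\<Sum>t\<in>T. d t * a t s') =
        a u s * (\<Sum>t\<in>T'. c t * a t s') - (\<Sum>t\<in>T'. c t * a t s) * a u s'" for s'
    proof -
      have "(\<Sum>t\<in>T'. d t * a t s') = a u s * (\<Sum>t\<in>T'. c t * a t s')"
        by (auto simp: d_def T'_def sum_distrib_left mult.assoc intro!: sum.cong)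
      then show ?thesis
        using sum.remove[OF insert.prems(1) u(1), of "\<lambda>t. d t * a t s'"]
        by (simp add: T'_def d_def)
    qed
    have "(\<Sum>t\<in>T. d t * a t s') = 0" if "s' \<in> S" for s'
      using eq[OF that] unfolding sum_d
      by (simp add: sum_distrib_left sum_distrib_right right_diff_distrib sum_subtractf ac_simps)
    moreover have "(\<Sum>t\<in>T. d t * a t s) = 0"
      unfolding sum_d by simp
    moreover have "\<exists>t\<in>T. d t \<noteq> 0"
      using c u by (auto simp: d_def T'_def)
    ultimately show ?thesis by blast
  qed
qed

lemma hom_finprod_free_Abelian_group:
  assumes "comm_group G" and h: "h \<in> hom G (free_Abelian_group S)"
    and "finite T" and "T \<subseteq> carrier G"
  shows "h (finprod G (\<lambda>x. x [^]\<^bsub>G\<^esub> (c x :: int)) T) = (\<Sum>x\<in>T. frag_cmul (c x) (h x))"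
proof -
  interpret comm_group G by fact
  interpret h: group_hom G "free_Abelian_group S" h
    by (intro group_hom.intro group_hom_axioms.intro is_group group_free_Abelian_group h)
  show ?thesis
    using assms(3,4)
  proof (induction T rule: finite_induct)
    case empty
    show ?case using h.hom_one by simp
  next
    case (insert x T)
    have "Poly_Mapping.keys (h x) \<subseteq> S"
      using insert.prems h.hom_closed[of x] by simp
    then have "h (x [^]\<^bsub>G\<^esub> c x) = frag_cmul (c x) (h x)"
      using insert.prems by (simp add: h.hom_int_pow)
    then show ?case
      using insert by (simp add: Pi_iff subset_iff h.hom_mult)
  qed
qed

text \<open>A relation among more than \<open>card S\<close> elements is a homogeneous system with
  more unknowns than equations, so no independent set is larger than \<open>S\<close>; the preimage
  of the standard basis attains the bound. Hence the supremum in \<open>rk\<close> is a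
  maximum.\<close>

lemma rk_eq_card_basis:
  assumes G: "group G" and iso: "G \<cong> free_Abelian_group S" and S: "finite S"
  shows "rk G = card S"
proof -
  let ?F = "free_Abelian_group S"
  have comm: "comm_group G"
    using comm_group.iso_imp_comm_group[OF abelian_free_Abelian_group group.iso_sym[OF G iso]] G
    by (simp add: group.is_monoid)
  obtain h where h: "h \<in> iso G ?F"
    using iso unfolding is_iso_def by blast
  then have hom: "h \<in> hom G ?F" and bij: "bij_betw h (carrier G) (carrier ?F)"
    by (auto simp: iso_def)
  interpret G: comm_group G by fact
  interpret h: group_hom G ?F h
    by (intro group_hom.intro group_hom_axioms.intro G group_free_Abelian_group hom)
  have ker: "finprod G (\<lambda>x. x [^]\<^bsub>G\<^esub> (c x :: int)) T = \<one>\<^bsub>G\<^esub> \<longleftrightarrow> (\<Sum>x\<in>T. frag_cmul (c x) (h x)) = 0"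
    if "finite T" "T \<subseteq> carrier G" for T c
  proof -
    have "finprod G (\<lambda>x. x [^]\<^bsub>G\<^esub> (c x :: int)) T \<in> carrier G"
      using that by (intro G.finprod_closed) auto
    then show ?thesis
      unfolding hom_finprod_free_Abelian_group[OF comm hom that, symmetric]
      using inj_onD[OF bij_betw_imp_inj_on[OF bij]] h.hom_one by fastforce
  qed
  have le: "card T \<le> card S" if "finite T" "int_independent G T" for T
  proof (rule ccontr)
    assume "\<not> card T \<le> card S"
    then have "card S < card T" by simp
    from homogeneous_system_nontrivial_solution[OF S \<open>finite T\<close> this, of "\<lambda>t. Poly_Mapping.lookup (h t)"]
    obtain c t where c: "t \<in> T" "c t \<noteq> 0"
      and eq: "\<And>s. s \<in> S \<Longrightarrow> (\<Sum>t\<in>T. c t * Poly_Mapping.lookup (h t) s) = 0"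
      by blast
    have T: "T \<subseteq> carrier G"
      using that by (simp add: int_independent_def)
    have "(\<Sum>t\<in>T. frag_cmul (c t) (h t)) = 0"
    proof (rule poly_mapping_eqI)
      fix s
      have "Poly_Mapping.lookup (h t) s = 0" if "s \<notin> S" "t \<in> T" for t
        using that T h.hom_closed[of t] by (auto simp: in_keys_iff subset_iff)
      then show "Poly_Mapping.lookup (\<Sum>t\<in>T. frag_cmul (c t) (h t)) s = Poly_Mapping.lookup 0 s"
        using eq by (cases "s \<in> S") (auto simp: lookup_sum)
    qed
    then show False
      using that c ker[OF that(1) T] unfolding int_independent_def by blast
  qed
  define B where "B = inv_into (carrier G) h ` frag_of ` S"
  have frag_S: "frag_of ` S \<subseteq> carrier ?F"
    by (auto simp: keys_frag_of)
  have inj_inv: "inj_on (inv_into (carrier G) h) (frag_of ` S)"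
    using bij frag_S by (metis bij_betw_imp_surj_on inj_on_inv_into)
  have B_carrier: "B \<subseteq> carrier G"
    unfolding B_def using frag_S bij by (metis bij_betw_imp_surj_on image_subsetI inv_into_into subsetD)
  have h_B: "\<exists>s\<in>S. h x = frag_of s" if "x \<in> B" for x
    using that frag_S bij_betw_imp_surj_on[OF bij] unfolding B_def
    by (fastforce simp: f_inv_into_f)
  have "card B = card S"
    unfolding B_def using card_image[OF inj_inv] by (simp add: card_image inj_on_def frag_of_eq)
  moreover have "int_independent G B"
    unfolding int_independent_def
  proof (intro conjI allI impI B_carrier)
    fix T and c :: "_ \<Rightarrow> int"
    assume T: "finite T" "T \<subseteq> B" and "finprod G (\<lambda>x. x [^]\<^bsub>G\<^esub> c x) T = \<one>\<^bsub>G\<^esub>"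
    then have zero: "(\<Sum>x\<in>T. frag_cmul (c x) (h x)) = 0"
      using ker B_carrier by (meson order_trans)
    show "\<forall>x\<in>T. c x = 0"
    proof
      fix x assume x: "x \<in> T"
      then obtain s where s: "s \<in> S" "h x = frag_of s" using h_B T by blast
      have "Poly_Mapping.lookup (h y) s = (if y = x then 1 else 0)" if y: "y \<in> T" for y
      proof -
        obtain s' where s': "h y = frag_of s'" using h_B T y by blast
        have "h y = h x \<longleftrightarrow> y = x"
          using bij T B_carrier x y by (meson bij_betw_imp_inj_on inj_on_eq_iff subsetD)
        then show ?thesis using s s' by (auto simp: frag_of_eq)
      qed
      then have "Poly_Mapping.lookup (\<Sum>x\<in>T. frag_cmul (c x) (h x)) s = (\<Sum>y\<in>T. if y = x then c x else 0)"
        by (auto simp: lookup_sum intro!: sum.cong)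
      then show "c x = 0"
        using zero x T by simp
    qed
  qed
  moreover have "finite B"
    unfolding B_def using S by simp
  ultimately have "card S \<in> {card T |T. finite T \<and> int_independent G T}"
    by (metis (mono_tags, lifting) mem_Collect_eq)
  then show ?thesis
    unfolding rk_def using le by (intro cSup_eq_maximum) auto
qed

lemma free_Abelian_group_iso_image:
  assumes "inj_on f S"
  shows "free_Abelian_group S \<cong> free_Abelian_group (f ` S)"
proof -
  define g where "g = inv_into S f"
  let ?h = "frag_extend (frag_of \<circ> f)" and ?k = "frag_extend (frag_of \<circ> g)"
  have keys: "Poly_Mapping.keys (frag_extend (frag_of \<circ> u) x) \<subseteq> u ` Poly_Mapping.keys x"
    for u :: "'x \<Rightarrow> 'y" and x
    using keys_frag_extend[of "frag_of \<circ> u" x] by (auto simp: keys_frag_of)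
  have kh: "?k (?h x) = x" if "Poly_Mapping.keys x \<subseteq> S" for x
  proof -
    have "?k (?h x) = frag_extend frag_of x"
      unfolding frag_extend_compose
      using that assms by (intro frag_extend_eq) (auto simp: g_def)
    then show ?thesis by (simp flip: frag_expansion)
  qed
  have hk: "?h (?k x) = x" if "Poly_Mapping.keys x \<subseteq> f ` S" for x
  proof -
    have "?h (?k x) = frag_extend frag_of x"
      unfolding frag_extend_compose
      using that by (intro frag_extend_eq) (auto simp: g_def f_inv_into_f)
    then show ?thesis by (simp flip: frag_expansion)
  qed
  have "?h \<in> hom (free_Abelian_group S) (free_Abelian_group (f ` S))"
    using keys[of f] by (intro homI) (fastforce simp: frag_extend_add)+
  moreover have "bij_betw ?h (carrier (free_Abelian_group S)) (carrier (free_Abelian_group (f ` S)))"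
  proof (rule bij_betw_byWitness[of _ ?k])
    show "?h ` carrier (free_Abelian_group S) \<subseteq> carrier (free_Abelian_group (f ` S))"
      using keys[of f] by fastforce
    have "g ` f ` S \<subseteq> S"
      using assms by (auto simp: g_def)
    then show "?k ` carrier (free_Abelian_group (f ` S)) \<subseteq> carrier (free_Abelian_group S)"
      using keys[of g] by fastforce
  qed (use kh hk in auto)
  ultimately show ?thesis
    by (auto simp: is_iso_def iso_def)
qed

lemma sum_group_free_iso:
  assumes "\<And>i. i \<in> I \<Longrightarrow> group (G i)" and "\<And>i. i \<in> I \<Longrightarrow> G i \<cong> free_Abelian_group (S i)"
    and "disjoint_family_on S I"
  shows "sum_group I G \<cong> free_Abelian_group (\<Union>i\<in>I. S i)"
proof -
  have "sum_group I G \<cong> sum_group I (\<lambda>i. free_Abelian_group (S i))"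
    using assms by (intro iso_sum_groupI) auto
  also have "\<dots> \<cong> free_Abelian_group (\<Union>i\<in>I. S i)"
    using iso_free_Abelian_group_sum[of S I] assms(3)
    by (auto simp: is_iso_def pairwise_def disjnt_def disjoint_family_on_def)
  finally show ?thesis .
qed

lemma UNIV_W_basis: "(UNIV :: W_basis set) = {w_plus, w_minus}"
  using W_basis.exhaust by blast

lemma finite_W_basis [simp]: "finite (A :: W_basis set)"
  by (rule finite_subset[OF subset_UNIV]) (simp add: UNIV_W_basis)

lemma graded_tensor_W_group: "group (graded_tensor I (\<lambda>_. W) n)"
  unfolding graded_tensor_def W_def
  by (intro sum_group tensor_group_group group.is_monoid group_free_Abelian_group)

text \<open>A labelling determines its multidegree, so the bases for different \<open>d\<close> are
  disjoint. Infinitely many \<open>d\<close> may have total degree \<open>n\<close>, but those with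
  a value other than 2 and -2 on \<open>I\<close> contribute an empty basis.\<close>

lemma graded_tensor_W_iso:
  assumes "finite I"
  shows "graded_tensor I (\<lambda>_. W) n \<cong> free_Abelian_group {b \<in> I \<rightarrow>\<^sub>E UNIV. (\<Sum>i\<in>I. W_deg (b i)) = n}"
proof -
  define M where "M = {d \<in> I \<rightarrow>\<^sub>E (UNIV :: int set). sum d I = n}"
  define S where "S d = (\<Pi>\<^sub>E i\<in>I. {w. W_deg w = d i})" for d
  have "graded_tensor I (\<lambda>_. W) n \<cong> free_Abelian_group (\<Union>d\<in>M. S d)"
    unfolding graded_tensor_def M_def[symmetric] W_def
  proof (rule sum_group_free_iso)
    show "tensor_group I (\<lambda>i. free_Abelian_group {w. W_deg w = d i}) \<cong> free_Abelian_group (S d)" for d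
      unfolding S_def using assms by (intro tensor_group_free_iso) auto
    have "d = d'" if "d \<in> M" "d' \<in> M" "b \<in> S d" "b \<in> S d'" for d d' b
    proof (rule PiE_ext)
      show "d \<in> I \<rightarrow>\<^sub>E UNIV" "d' \<in> I \<rightarrow>\<^sub>E UNIV" using that by (auto simp: M_def)
      show "d i = d' i" if "i \<in> I" for i
        using \<open>b \<in> S d\<close> \<open>b \<in> S d'\<close> that by (auto simp: S_def PiE_iff)
    qed
    then show "disjoint_family_on S M"
      unfolding disjoint_family_on_def by blast
  qed (intro tensor_group_group group.is_monoid group_free_Abelian_group)
  also have "(\<Union>d\<in>M. S d) = {b \<in> I \<rightarrow>\<^sub>E UNIV. (\<Sum>i\<in>I. W_deg (b i)) = n}"
  proof (intro equalityI subsetI)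
    fix b assume b: "b \<in> {b \<in> I \<rightarrow>\<^sub>E UNIV. (\<Sum>i\<in>I. W_deg (b i)) = n}"
    define d where "d = (\<lambda>i\<in>I. W_deg (b i))"
    have "d \<in> M" "b \<in> S d"
      using b by (auto simp: d_def M_def S_def PiE_iff)
    then show "b \<in> (\<Union>d\<in>M. S d)" by blast
  next
    fix b assume "b \<in> (\<Union>d\<in>M. S d)"
    then obtain d where "d \<in> M" "b \<in> S d" by blast
    moreover from this have "(\<Sum>i\<in>I. W_deg (b i)) = sum d I"
      by (intro sum.cong) (auto simp: S_def PiE_iff)
    ultimately show "b \<in> {b \<in> I \<rightarrow>\<^sub>E UNIV. (\<Sum>i\<in>I. W_deg (b i)) = n}"
      by (auto simp: M_def S_def PiE_iff)
  qed
  finally show ?thesis .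
qed

section \<open>The graded dimension of the complex as a sum over states\<close>

lemma finite_gen_classes: "finite (half_edges D) \<Longrightarrow> finite (gen_classes D F)"
  unfolding gen_classes_def Let_def quotient_def by simp

lemma finite_half_edges: "finite (crossings D) \<Longrightarrow> finite (half_edges D)"
  by (simp add: half_edges_def)

lemma finite_circles: "finite (crossings D) \<Longrightarrow> finite (circles D s)"
  by (simp add: circles_def finite_gen_classes finite_half_edges)

lemma finite_states:
  assumes "finite (crossings D)"
  shows "finite (states D)"
proof -
  have "UNIV \<subseteq> {A_mark, B_mark}"
    using mark.exhaust by blast
  then have "finite (UNIV :: mark set)"
    by (rule finite_subset) simp
  with assms show ?thesis
    unfolding states_def by (intro finite_PiE)
qed

lemma A_pow_0: "A_pow 0 = 1"
  by (simp add: A_pow_def)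

lemma A_pow_add: "A_pow (k + l) = A_pow k * A_pow l"
  by (simp add: A_pow_def mult_single)

lemma A_pow_sum: "A_pow (sum f I) = (\<Prod>i\<in>I. A_pow (f i))"
  by (induction I rule: infinite_finite_induct) (simp_all add: A_pow_0 A_pow_add)

lemma qdim_eq_sum_degrees:
  assumes M: "finite M" and rk: "\<And>j. rk (G j) = card {x \<in> M. wt x = j}"
  shows "qdim G = (\<Sum>x\<in>M. A_pow (wt x))"
proof -
  have "(\<Sum>x\<in>M. A_pow (wt x)) = (\<Sum>j\<in>wt ` M. \<Sum>x\<in>{x \<in> M. wt x = j}. A_pow (wt x))"
    using M by (rule sum.image_gen)
  also have "\<dots> = (\<Sum>j\<in>wt ` M. of_nat (rk (G j)) * A_pow j)"
    by (intro sum.cong) (auto simp: rk)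
  also have "wt ` M = {j. rk (G j) \<noteq> 0}"
    using M by (auto simp: rk card_eq_0_iff)
  finally show ?thesis by (simp add: qdim_def)
qed

lemma rk_bracket_complex:
  assumes "finite (crossings D)"
  shows "rk (bracket_complex D i j) =
    card {(s, b). s \<in> states D \<and> (b_count D s + card (circles D (state_A D))) mod 2 = i \<and>
      b \<in> circles D s \<rightarrow>\<^sub>E UNIV \<and> int (a_count D s) - int (b_count D s) + (\<Sum>c\<in>circles D s. W_deg (b c)) = j}"
proof -
  define St where "St = {s \<in> states D. (b_count D s + card (circles D (state_A D))) mod 2 = i}"
  define B where "B s = {b \<in> circles D s \<rightarrow>\<^sub>E UNIV.
    (\<Sum>c\<in>circles D s. W_deg (b c)) = j - (int (a_count D s) - int (b_count D s))}" for s
  have group: "group (W_state D s j)" for s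
    by (simp add: W_state_def shift_def graded_tensor_W_group)
  \<comment> \<open>The sets \<open>B s\<close> may coincide: two states with a single circle
    through all half-edges have the same labellings. Pairing with \<open>s\<close> separates
    them.\<close>
  have "W_state D s j \<cong> free_Abelian_group (Pair s ` B s)" for s
  proof -
    have "W_state D s j \<cong> free_Abelian_group (B s)"
      unfolding W_state_def shift_def B_def
      by (rule graded_tensor_W_iso[OF finite_circles[OF assms]])
    also have "\<dots> \<cong> free_Abelian_group (Pair s ` B s)"
      by (rule free_Abelian_group_iso_image) (simp add: inj_on_def)
    finally show ?thesis .
  qed
  then have iso: "bracket_complex D i j \<cong> free_Abelian_group (\<Union>s\<in>St. Pair s ` B s)"
    unfolding bracket_complex_def direct_sum_def St_def[symmetric]
    by (intro sum_group_free_iso group) (auto simp: disjoint_family_on_def)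
  have "finite St"
    using finite_states[OF assms] by (simp add: St_def)
  moreover have "finite (B s)" for s
    unfolding B_def by (rule finite_subset[OF _ finite_PiE[OF finite_circles[OF assms]]]) auto
  ultimately have "rk (bracket_complex D i j) = card (\<Union>s\<in>St. Pair s ` B s)"
    by (intro rk_eq_card_basis[OF _ iso]) (auto simp: bracket_complex_def direct_sum_def group)
  also have "(\<Union>s\<in>St. Pair s ` B s) = {(s, b). s \<in> states D \<and>
      (b_count D s + card (circles D (state_A D))) mod 2 = i \<and> b \<in> circles D s \<rightarrow>\<^sub>E UNIV \<and>
      int (a_count D s) - int (b_count D s) + (\<Sum>c\<in>circles D s. W_deg (b c)) = j}"
    by (auto simp: St_def B_def)
  finally show ?thesis .
qed

lemma qdim_bracket_complex:
  assumes "finite (crossings D)"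
  shows "qdim (bracket_complex D i) =
    (\<Sum>s | s \<in> states D \<and> (b_count D s + card (circles D (state_A D))) mod 2 = i.
       A_pow (int (a_count D s) - int (b_count D s)) * (A_pow 2 + A_pow (- 2)) ^ card (circles D s))"
proof -
  define St where "St = {s \<in> states D. (b_count D s + card (circles D (state_A D))) mod 2 = i}"
  define B where "B s = (circles D s \<rightarrow>\<^sub>E (UNIV :: W_basis set))" for s
  define e where "e s = int (a_count D s) - int (b_count D s)" for s
  have fin: "finite St" "finite (B s)" for s
    using finite_states[OF assms] finite_circles[OF assms] by (auto simp: St_def B_def intro: finite_PiE)
  have "qdim (bracket_complex D i) =
      (\<Sum>x\<in>Sigma St B. A_pow (case x of (s, b) \<Rightarrow> e s + (\<Sum>c\<in>circles D s. W_deg (b c))))"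
  proof (rule qdim_eq_sum_degrees)
    show "finite (Sigma St B)" using fin by blast
    show "rk (bracket_complex D i j) =
        card {x \<in> Sigma St B. (case x of (s, b) \<Rightarrow> e s + (\<Sum>c\<in>circles D s. W_deg (b c))) = j}" for j
      unfolding rk_bracket_complex[OF assms]
      by (rule arg_cong[of _ _ card]) (auto simp: St_def B_def e_def)
  qed
  also have "\<dots> = (\<Sum>s\<in>St. \<Sum>b\<in>B s. A_pow (e s) * (\<Prod>c\<in>circles D s. A_pow (W_deg (b c))))"
    using fin by (simp add: sum.Sigma A_pow_add A_pow_sum case_prod_unfold)
  also have "\<dots> = (\<Sum>s\<in>St. A_pow (e s) * (A_pow 2 + A_pow (- 2)) ^ card (circles D s))"
  proof (rule sum.cong[OF refl])
    fix s
    have "(\<Sum>b\<in>B s. \<Prod>c\<in>circles D s. A_pow (W_deg (b c))) =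
        (\<Prod>c\<in>circles D s. \<Sum>w\<in>UNIV. A_pow (W_deg w))"
      unfolding B_def by (rule prod_sum_PiE[symmetric]) (simp_all add: finite_circles assms)
    also have "\<dots> = (A_pow 2 + A_pow (- 2)) ^ card (circles D s)"
      by (simp add: UNIV_W_basis)
    finally show "(\<Sum>b\<in>B s. A_pow (e s) * (\<Prod>c\<in>circles D s. A_pow (W_deg (b c)))) =
        A_pow (e s) * (A_pow 2 + A_pow (- 2)) ^ card (circles D s)"
      by (simp flip: sum_distrib_left)
  qed
  finally show ?thesis by (simp add: St_def e_def)
qed

section \<open>Counting the cycles of a permutation modulo 2\<close>

lemma card_image_eq_if_same_fibres:
  assumes "\<And>x y. x \<in> S \<Longrightarrow> y \<in> S \<Longrightarrow> f x = f y \<longleftrightarrow> g x = g y"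
  shows "card (f ` S) = card (g ` S)"
proof (rule bij_betw_same_card[OF bij_betw_byWitness])
  let ?h = "\<lambda>C. g (inv_into S f C)" and ?k = "\<lambda>C. f (inv_into S g C)"
  have f: "f (inv_into S f (f x)) = f x" "inv_into S f (f x) \<in> S" if "x \<in> S" for x
    using that by (auto intro: f_inv_into_f inv_into_into)
  have g: "g (inv_into S g (g x)) = g x" "inv_into S g (g x) \<in> S" if "x \<in> S" for x
    using that by (auto intro: f_inv_into_f inv_into_into)
  have fg: "?h (f x) = g x" "?k (g x) = f x" if "x \<in> S" for x
    using f[OF that] g[OF that] assms that by blast+
  show "\<forall>C\<in>f ` S. ?k (?h C) = C" "\<forall>C\<in>g ` S. ?h (?k C) = C"
    "?h ` f ` S \<subseteq> g ` S" "?k ` g ` S \<subseteq> f ` S"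
    by (auto simp: fg)
qed

lemma orbit_eq_iff:
  assumes "permutation p"
  shows "orbit p x = orbit p y \<longleftrightarrow> y \<in> orbit p x"
proof
  assume "y \<in> orbit p x"
  moreover from this have "x \<in> orbit p y"
    using permutation_self_in_orbit[OF assms] orbit_swap by metis
  ultimately show "orbit p x = orbit p y"
    by (blast intro: orbit_trans)
qed (use permutation_self_in_orbit[OF assms] in blast)

text \<open>Composing with a transposition that moves a fixed point \<open>a\<close> inserts \<open>a\<close> into the cycle of
  another point.\<close>

lemma orbit_transpose_fixpoint:
  assumes "q permutes S" and "a \<notin> S" and "b \<in> S" and p: "p = transpose a b \<circ> q"
    and "x \<in> S" and "y \<in> S"
  shows "y \<in> orbit p x \<longleftrightarrow> y \<in> orbit q x"
proof -
  have qa: "q a = a"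
    using assms by (simp add: permutes_not_in)
  have inj: "q u = q v \<longleftrightarrow> u = v" for u v
    using assms(1) by (metis permutes_inverses(2))
  have pa: "p a = b" using qa by (simp add: p)
  have "a \<noteq> b" using assms by blast
  have q_eq: "q z = (if p z = a then b else p z)" if "z \<noteq> a" for z
    using that inj[of z a] qa by (auto simp: p transpose_def)
  have [simp]: "q z \<in> S \<longleftrightarrow> z \<in> S" for z
    using assms(1) by (rule permutes_in_image)
  have S: "z \<in> S \<Longrightarrow> z \<noteq> a" for z
    using \<open>a \<notin> S\<close> by blast
  have q_orbit: "q z \<in> orbit p x" if "p z \<in> orbit p x" "z \<noteq> a" for z
    using q_eq[OF that(2)] that(1) orbit.step[OF that(1)] pa by (auto split: if_splits)
  have "z \<in> S \<and> z \<in> orbit p x" if "z \<in> orbit q x" for z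
    using that
  proof induction
    case base
    show ?case
      using \<open>x \<in> S\<close> S by (simp add: q_orbit orbit.base)
  next
    case (step z)
    then show ?case
      using S by (simp add: q_orbit orbit.step)
  qed
  \<comment> \<open>\<open>p\<close> leads from the preimage of \<open>b\<close> under
    \<open>q\<close> first to \<open>a\<close> and then to \<open>b\<close>. Identifying
    \<open>a\<close> with \<open>b\<close> collapses this detour, so a walk of \<open>p\<close>
    becomes one of \<open>q\<close>.\<close>
  moreover have "(if z = a then b else z) \<in> orbit q x" if "z \<in> orbit p x" for z
    using that
  proof induction
    case base
    show ?case
      using q_eq[of x] orbit.base[of q x] S[OF \<open>x \<in> S\<close>] by auto
  next
    case (step z)
    then show ?case
      using q_eq[of z] orbit.step[of z q x] pa \<open>a \<noteq> b\<close> by (cases "z = a") auto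
  qed
  ultimately show ?thesis
    using S[OF \<open>y \<in> S\<close>] by (metis (full_types))
qed

text \<open>Removing \<open>a\<close> from its cycle writes \<open>p\<close> as a transposition
  times a permutation \<open>q\<close> of \<open>S\<close>. If \<open>p\<close> fixes
  \<open>a\<close>, a point and a cycle are lost and the sign stays; otherwise a point is lost, the
  number of cycles stays and the sign changes.\<close>

lemma minus_one_power_card_orbits:
  assumes "finite S" and "p permutes S"
  shows "(- 1) ^ card (orbit p ` S) = (- 1) ^ card S * sign p"
  using assms
proof (induction S arbitrary: p rule: finite_induct)
  case (insert a S)
  define b where "b = p a"
  define q where "q = transpose a b \<circ> p"
  have q: "q permutes S"
    unfolding q_def b_def using insert.prems by (rule permutes_insert_lemma)
  have p: "p = transpose a b \<circ> q"
    by (simp add: q_def fun_eq_iff)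
  have perm: "permutation p" "permutation q"
    using insert q by (auto simp: permutation_permutes)
  show ?case
  proof (cases "b = a")
    case True
    then have "p = q" by (simp add: p)
    have "z = a" if "z \<in> orbit p a" for z
      using that True unfolding b_def by induction auto
    then have "orbit p a = {a}"
      using permutation_self_in_orbit[OF perm(1), of a] by blast
    moreover have "{a} \<notin> orbit p ` S"
      using permutes_orbit_subset[OF q] insert.hyps \<open>p = q\<close> by blast
    ultimately show ?thesis
      using insert.IH[OF q] insert.hyps \<open>p = q\<close> by simp
  next
    case False
    have "b \<in> S"
      using insert.prems False unfolding b_def by (metis insertE insertI1 permutes_in_image)
    have "orbit p a = orbit p b"
      unfolding b_def by (rule permutation_orbit_step[OF perm(1), symmetric])
    then have "orbit p ` insert a S = orbit p ` S"
      using \<open>b \<in> S\<close> by auto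
    moreover have "card (orbit p ` S) = card (orbit q ` S)"
      using orbit_transpose_fixpoint[OF q insert.hyps(2) \<open>b \<in> S\<close> p]
      by (intro card_image_eq_if_same_fibres) (simp add: orbit_eq_iff perm)
    moreover have "sign p = - sign q"
      using False perm(2) sign_compose[OF permutation_swap_id perm(2), of a b] by (simp add: p sign_swap_id)
    ultimately show ?thesis
      using insert.IH[OF q] insert.hyps by simp
  qed
qed simp

section \<open>Checkerboard colourings from Euler's formula\<close>

definition gen_rel ::
    "'c diagram \<Rightarrow> ('c half_edge \<Rightarrow> 'c half_edge) set \<Rightarrow> ('c half_edge \<times> 'c half_edge) set" where
  "gen_rel D F = {(x, y). x \<in> half_edges D \<and> y \<in> half_edges D \<and>
     (x, y) \<in> ({(h, f h) | h f. h \<in> half_edges D \<and> f \<in> F} \<union> converse {(h, f h) | h f. h \<in> half_edges D \<and> f \<in> F})\<^sup>*}"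

lemma gen_classes_eq: "gen_classes D F = half_edges D // gen_rel D F"
  unfolding gen_classes_def gen_rel_def Let_def by (rule refl)

lemma equiv_gen_rel: "equiv (half_edges D) (gen_rel D F)"
proof (rule equivI)
  show "sym (gen_rel D F)"
    unfolding gen_rel_def sym_def
    by (clarsimp, metis (no_types, lifting) converse_Un converse_converse rtrancl_converseI sup_commute)
  show "trans (gen_rel D F)"
    unfolding gen_rel_def trans_def by (auto intro: rtrancl_trans)
qed (auto simp: gen_rel_def refl_on_def)

lemma gen_rel_step:
  assumes "h \<in> half_edges D" and "f \<in> F" and "f h \<in> half_edges D"
  shows "(h, f h) \<in> gen_rel D F"
  unfolding gen_rel_def using assms
  by (intro CollectI case_prodI conjI r_into_rtrancl UnI1) blast+

lemma gen_rel_invariant: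
  assumes "(x, y) \<in> gen_rel D F" and "\<And>h f. h \<in> half_edges D \<Longrightarrow> f \<in> F \<Longrightarrow> P (f h) \<longleftrightarrow> P h"
  shows "P x \<longleftrightarrow> P y"
proof -
  have "(x, y) \<in> ({(h, f h) | h f. h \<in> half_edges D \<and> f \<in> F} \<union> converse {(h, f h) | h f. h \<in> half_edges D \<and> f \<in> F})\<^sup>*"
    using assms(1) by (simp add: gen_rel_def)
  then show ?thesis
    by induction (auto simp: assms(2))
qed

lemma gen_rel_in_half_edges: "(x, y) \<in> gen_rel D F \<Longrightarrow> x \<in> half_edges D \<and> y \<in> half_edges D"
  by (simp add: gen_rel_def)

lemma gen_classes_image: "gen_classes D F = (\<lambda>h. gen_rel D F `` {h}) ` half_edges D"
  by (auto simp: gen_classes_eq quotient_def)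

lemma gen_class_subset: "C \<in> gen_classes D F \<Longrightarrow> C \<subseteq> half_edges D"
  by (auto simp: gen_classes_image dest: gen_rel_in_half_edges)

lemma gen_class_eq_iff:
  assumes "h \<in> half_edges D" and "C \<in> gen_classes D F"
  shows "C = gen_rel D F `` {h} \<longleftrightarrow> h \<in> C"
proof -
  obtain k where k: "k \<in> half_edges D" "C = gen_rel D F `` {k}"
    using assms(2) unfolding gen_classes_image by blast
  show ?thesis
    unfolding k(2) Image_singleton_iff
    using eq_equiv_class_iff[OF equiv_gen_rel k(1) assms(1)] by simp
qed

lemma gen_class_closed:
  assumes "C \<in> gen_classes D F" and "f \<in> F" and "h \<in> half_edges D" and "f h \<in> half_edges D"
  shows "f h \<in> C \<longleftrightarrow> h \<in> C"
  using equiv_class_eq[OF equiv_gen_rel gen_rel_step[OF assms(3,2,4)]]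
    gen_class_eq_iff[OF assms(3,1)] gen_class_eq_iff[OF assms(4,1)] by simp

section \<open>Subsets as vectors over the field with two elements\<close>

lemma odd_card_sym_diff:
  assumes "finite A" and "finite B"
  shows "odd (card (sym_diff A B)) \<longleftrightarrow> odd (card A) \<noteq> odd (card B)"
proof -
  have "card (sym_diff A B) = card (A - B) + card (B - A)"
    using assms by (intro card_Un_disjoint) auto
  moreover have "card A = card (A - B) + card (A \<inter> B)" "card B = card (B - A) + card (A \<inter> B)"
    using assms card_Int_Diff[of A B] card_Int_Diff[of B A] by (auto simp: Int_commute)
  ultimately show ?thesis by presburger
qed

text \<open>A telescoping sum modulo 2: along the closed cycles of \<open>\<phi>\<close>, a
  two-valued function changes its value an even number of times.\<close>

lemma even_card_changes:
  fixes u :: "'a \<Rightarrow> bool"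
  assumes "finite C" and "bij_betw \<phi> C C"
  shows "even (card {h \<in> C. u h \<noteq> u (\<phi> h)})"
proof -
  have "bij_betw \<phi> {h \<in> C. u (\<phi> h)} {h \<in> C. u h}"
    using assms(2) by (auto simp: bij_betw_def inj_on_def image_iff)
  then have "card {h \<in> C. u (\<phi> h)} = card {h \<in> C. u h}"
    by (rule bij_betw_same_card)
  moreover have "{h \<in> C. u h \<noteq> u (\<phi> h)} = sym_diff {h \<in> C. u h} {h \<in> C. u (\<phi> h)}"
    by auto
  ultimately show ?thesis
    using odd_card_sym_diff[of "{h \<in> C. u h}" "{h \<in> C. u (\<phi> h)}"] assms(1) by simp
qed

text \<open>Rank-nullity over the field with two elements: the power set of \<open>M\<close> with symmetric difference is
  the vector space with basis \<open>M\<close>.\<close>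

lemma card_image_times_card_kernel:
  assumes "finite M"
    and add: "\<And>P Q. P \<subseteq> M \<Longrightarrow> Q \<subseteq> M \<Longrightarrow> f (sym_diff P Q) = sym_diff (f P) (f Q)"
  shows "card (f ` Pow M) * card {P \<in> Pow M. f P = {}} = 2 ^ card M"
proof -
  let ?K = "{P \<in> Pow M. f P = {}}"
  have fibre: "card {P \<in> Pow M. f P = Y} = card ?K" if "Y \<in> f ` Pow M" for Y
  proof -
    obtain Q where Q: "Q \<subseteq> M" "Y = f Q" using \<open>Y \<in> f ` Pow M\<close> by auto
    have "bij_betw (sym_diff Q) {P \<in> Pow M. f P = Y} ?K"
    proof (rule bij_betw_byWitness[of _ "sym_diff Q"])
      show "sym_diff Q ` {P \<in> Pow M. f P = Y} \<subseteq> ?K"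
        using Q add[of Q] by auto
      show "sym_diff Q ` ?K \<subseteq> {P \<in> Pow M. f P = Y}"
        using Q add[of Q] by auto
    qed auto
    then show ?thesis by (rule bij_betw_same_card)
  qed
  have "2 ^ card M = (\<Sum>P\<in>Pow M. 1 :: nat)"
    using assms(1) by (simp add: card_Pow)
  also have "\<dots> = (\<Sum>Y\<in>f ` Pow M. \<Sum>P\<in>{P \<in> Pow M. f P = Y}. 1)"
    using assms(1) by (intro sum.image_gen) simp
  also have "\<dots> = card (f ` Pow M) * card ?K"
    using fibre by simp
  finally show ?thesis by simp
qed

text \<open>A codimension bound in terms of cardinalities: if \<open>R\<close> spans the quotient by
  \<open>\<I>\<close>, every vector is the sum of one from \<open>\<I>\<close> and one from
  \<open>Pow R\<close>.\<close>

lemma card_Pow_le_if_cokernel_spanned: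
  assumes "finite V" and "finite R" and "\<I> \<subseteq> Pow V"
    and "\<And>S. S \<subseteq> V \<Longrightarrow> \<exists>Q\<subseteq>R. sym_diff S Q \<in> \<I>"
  shows "2 ^ card V \<le> card \<I> * 2 ^ card R"
proof -
  have fin: "finite \<I>" using assms(1,3) by (meson finite_Pow_iff finite_subset)
  have "Pow V \<subseteq> (\<lambda>(P, Q). sym_diff P Q) ` (\<I> \<times> Pow R)"
  proof
    fix S assume "S \<in> Pow V"
    then obtain Q where Q: "Q \<subseteq> R" "sym_diff S Q \<in> \<I>" using assms(4) by blast
    have "S = sym_diff (sym_diff S Q) Q" by blast
    then show "S \<in> (\<lambda>(P, Q). sym_diff P Q) ` (\<I> \<times> Pow R)"
      using Q by (auto intro!: image_eqI[of _ _ "(sym_diff S Q, Q)"])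
  qed
  then have "card (Pow V) \<le> card (\<I> \<times> Pow R)"
    using fin assms(2) by (meson card_image_le card_mono finite_Pow_iff finite_SigmaI finite_imageI le_trans)
  then show ?thesis
    using assms(1,2) by (simp add: card_Pow card_cartesian_product)
qed

lemma Collect_doubleton:
  "{k \<in> {x, y}. Q k} = (if Q x then {x} else {}) \<union> (if Q y then {y} else {})"
  by auto

text \<open>Everything in \<open>link_diagram\<close> except Euler's formula. Such data describe a
  graph cellularly embedded in a closed oriented surface of arbitrary genus, whose faces are the
  cycles of \<open>\<phi>\<close>.\<close>

locale four_valent_graph =
  fixes D :: "'c diagram"
  assumes finite_crossings: "finite (crossings D)"
    and opp_closed: "h \<in> half_edges D \<Longrightarrow> opp D h \<in> half_edges D"
    and opp_neq: "h \<in> half_edges D \<Longrightarrow> opp D h \<noteq> h"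
    and opp_opp: "h \<in> half_edges D \<Longrightarrow> opp D (opp D h) = h"
begin

abbreviation H where "H \<equiv> half_edges D"
abbreviation \<alpha> where "\<alpha> \<equiv> opp D"
abbreviation \<phi> where "\<phi> \<equiv> rot \<circ> opp D"
abbreviation face where "face h \<equiv> gen_rel D {\<phi>} `` {h}"

lemma finite_H: "finite H"
  using finite_crossings by (rule finite_half_edges)

lemma rot_closed: "h \<in> H \<Longrightarrow> rot h \<in> H"
  by (auto simp: half_edges_def rot_def)

lemma finite_classes: "finite (gen_classes D F)"
  using finite_H by (rule finite_gen_classes)

lemma finite_gen_class: "C \<in> gen_classes D F \<Longrightarrow> finite C"
  using finite_H gen_class_subset finite_subset by metis

lemma edge_class: "h \<in> H \<Longrightarrow> gen_rel D {\<alpha>} `` {h} = {h, \<alpha> h}"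
proof (intro equalityI subsetI)
  fix k assume h: "h \<in> H" and "k \<in> gen_rel D {\<alpha>} `` {h}"
  then have "(h, k) \<in> gen_rel D {\<alpha>}" by simp
  then have "h \<in> {h, \<alpha> h} \<longleftrightarrow> k \<in> {h, \<alpha> h}"
  proof (rule gen_rel_invariant)
    fix x f assume "x \<in> H" "f \<in> {\<alpha>}"
    then show "f x \<in> {h, \<alpha> h} \<longleftrightarrow> x \<in> {h, \<alpha> h}"
      using h opp_opp by (metis insert_iff singletonD)
  qed
  then show "k \<in> {h, \<alpha> h}" by simp
next
  fix k assume h: "h \<in> H" and "k \<in> {h, \<alpha> h}"
  then show "k \<in> gen_rel D {\<alpha>} `` {h}"
    using gen_rel_step[OF h, of \<alpha> "{\<alpha>}"] opp_closed[OF h] equiv_class_self[OF equiv_gen_rel h] by auto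
qed

lemma edges_eq: "edges D = (\<lambda>h. {h, \<alpha> h}) ` H"
  unfolding edges_def gen_classes_image by (intro image_cong) (simp_all add: edge_class)

lemma in_Union_edges_iff:
  assumes "g \<subseteq> edges D" and "h \<in> H"
  shows "h \<in> \<Union>g \<longleftrightarrow> {h, \<alpha> h} \<in> g"
proof
  assume "h \<in> \<Union>g"
  then obtain k where k: "{k, \<alpha> k} \<in> g" "h \<in> {k, \<alpha> k}" "k \<in> H"
    using assms(1) unfolding edges_eq by auto
  then have "{h, \<alpha> h} = {k, \<alpha> k}"
    using opp_opp[OF k(3)] by (metis doubleton_eq_iff empty_iff insert_iff)
  with k show "{h, \<alpha> h} \<in> g" by simp
qed auto

lemma face_step_closed: "C \<in> faces D \<Longrightarrow> h \<in> H \<Longrightarrow> \<phi> h \<in> C \<longleftrightarrow> h \<in> C"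
  unfolding faces_def by (rule gen_class_closed) (auto simp: rot_closed opp_closed)

lemma bij_betw_face:
  assumes "C \<in> faces D"
  shows "bij_betw \<phi> C C"
proof -
  have CH: "C \<subseteq> H" and fin: "finite C"
    using assms gen_class_subset finite_gen_class unfolding faces_def by blast+
  have "inj_on rot H"
  proof
    fix x y assume "x \<in> H" "y \<in> H" "rot x = rot y"
    then have "snd x < 4" "snd y < 4" "fst x = fst y" "(snd x + 1) mod 4 = (snd y + 1) mod 4"
      by (auto simp: half_edges_def rot_def)
    moreover have "(n + 1) mod 4 = (if n = 3 then 0 else n + 1)" if "n < 4" for n :: nat
      using that by auto
    ultimately have "snd x = snd y" by (simp split: if_splits)
    with \<open>fst x = fst y\<close> show "x = y" by (simp add: prod_eq_iff)
  qed
  moreover have "inj_on \<alpha> H"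
    by (rule inj_on_inverseI[of _ \<alpha>]) (rule opp_opp)
  moreover have "\<alpha> ` H \<subseteq> H"
    using opp_closed by blast
  ultimately have "inj_on \<phi> C"
    using CH by (meson comp_inj_on inj_on_subset)
  moreover have "\<phi> ` C \<subseteq> C"
    using assms CH face_step_closed by blast
  ultimately show ?thesis
    using fin unfolding bij_betw_def by (metis endo_inj_surj)
qed

text \<open>The cellular cochain complex modulo 2 of the surface that carries the diagram, a cochain being
  the set of cells on which it is 1.\<close>

definition vertex_cobound where
  "vertex_cobound P = {e \<in> edges D. odd (card {h \<in> e. fst h \<in> P})}"

text \<open>Half-edges are counted, not edges: an edge with \<open>C\<close> on both sides counts
  twice, hence vanishes modulo 2.\<close>

definition edge_cobound where
  "edge_cobound g = {C \<in> faces D. odd (card (C \<inter> \<Union>g))}"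

lemma vertex_cobound_iff:
  assumes "h \<in> H"
  shows "{h, \<alpha> h} \<in> vertex_cobound P \<longleftrightarrow> (fst h \<in> P) \<noteq> (fst (\<alpha> h) \<in> P)"
proof -
  have "{k \<in> {h, \<alpha> h}. fst k \<in> P} =
      (if fst h \<in> P then {h} else {}) \<union> (if fst (\<alpha> h) \<in> P then {\<alpha> h} else {})"
    by (rule Collect_doubleton)
  moreover have "{h, \<alpha> h} \<in> edges D"
    using assms by (simp add: edges_eq)
  ultimately show ?thesis
    using opp_neq[OF assms] unfolding vertex_cobound_def by simp
qed

lemma vertex_cobound_sym_diff:
  "vertex_cobound (sym_diff P Q) = sym_diff (vertex_cobound P) (vertex_cobound Q)"
proof -
  have "odd (card {h \<in> e. fst h \<in> sym_diff P Q}) \<longleftrightarrow>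
      odd (card {h \<in> e. fst h \<in> P}) \<noteq> odd (card {h \<in> e. fst h \<in> Q})" if "e \<in> edges D" for e
  proof -
    have "finite e" using that by (auto simp: edges_eq)
    moreover have "{h \<in> e. fst h \<in> sym_diff P Q} = sym_diff {h \<in> e. fst h \<in> P} {h \<in> e. fst h \<in> Q}"
      by auto
    ultimately show ?thesis
      using odd_card_sym_diff[of "{h \<in> e. fst h \<in> P}" "{h \<in> e. fst h \<in> Q}"] by simp
  qed
  then show ?thesis unfolding vertex_cobound_def by blast
qed

text \<open>Distinct edges are disjoint, so passing from a set of edges to the set of their
  half-edges preserves symmetric differences.\<close>

lemma edge_cobound_sym_diff:
  assumes "g \<subseteq> edges D" and "g' \<subseteq> edges D"
  shows "edge_cobound (sym_diff g g') = sym_diff (edge_cobound g) (edge_cobound g')"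
proof -
  have "odd (card (C \<inter> \<Union>(sym_diff g g'))) \<longleftrightarrow> odd (card (C \<inter> \<Union>g)) \<noteq> odd (card (C \<inter> \<Union>g'))"
    if "C \<in> faces D" for C
  proof -
    have C: "finite C" "C \<subseteq> H"
      using that finite_gen_class gen_class_subset unfolding faces_def by blast+
    have "C \<inter> \<Union>(sym_diff g g') = sym_diff (C \<inter> \<Union>g) (C \<inter> \<Union>g')"
    proof (rule Set.set_eqI)
      fix h
      have "sym_diff g g' \<subseteq> edges D" using assms by blast
      then show "h \<in> C \<inter> \<Union>(sym_diff g g') \<longleftrightarrow> h \<in> sym_diff (C \<inter> \<Union>g) (C \<inter> \<Union>g')"
        using in_Union_edges_iff assms C(2) by (cases "h \<in> H") (auto simp del: Union_iff)
    qed
    then show ?thesis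
      using odd_card_sym_diff[of "C \<inter> \<Union>g" "C \<inter> \<Union>g'"] C(1) by simp
  qed
  then show ?thesis unfolding edge_cobound_def by blast
qed

text \<open>Around a face \<open>u\<close> changes an even number of times, and the changes occur
  exactly at the edges in \<open>g\<close>. This serves twice: with membership of the crossing in
  \<open>P\<close> it shows that the composite of the two coboundaries is zero, and with the parity
  of the position it yields the cocycle behind the colouring.\<close>

lemma edge_cobound_eq_empty:
  fixes u :: "'c half_edge \<Rightarrow> bool"
  assumes "g \<subseteq> edges D" and "\<And>h. h \<in> H \<Longrightarrow> {h, \<alpha> h} \<in> g \<longleftrightarrow> u h \<noteq> u (\<phi> h)"
  shows "edge_cobound g = {}"
proof -
  have "even (card (C \<inter> \<Union>g))" if "C \<in> faces D" for C
  proof -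
    have C: "finite C" "C \<subseteq> H"
      using that finite_gen_class gen_class_subset unfolding faces_def by blast+
    have "C \<inter> \<Union>g = {h \<in> C. u h \<noteq> u (\<phi> h)}"
      using in_Union_edges_iff[OF assms(1)] assms(2) C(2) by blast
    then show ?thesis
      using even_card_changes[OF C(1) bij_betw_face[OF that], of u] by simp
  qed
  then show ?thesis by (auto simp: edge_cobound_def)
qed

lemma edge_cobound_vertex_cobound: "edge_cobound (vertex_cobound P) = {}"
  by (rule edge_cobound_eq_empty[of _ "\<lambda>h. fst h \<in> P"])
    (auto simp: vertex_cobound_iff rot_def, simp add: vertex_cobound_def)

text \<open>Cohomology in degree 0: a set of crossings with zero coboundary is constant along each
  component, hence determined by the components it meets.\<close>

lemma card_vertex_kernel_le:
  "card {P \<in> Pow (crossings D). vertex_cobound P = {}} \<le> 2 ^ card (components D)"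
proof -
  let ?K = "{P \<in> Pow (crossings D). vertex_cobound P = {}}"
  let ?f = "\<lambda>P. {C \<in> components D. \<exists>h\<in>C. fst h \<in> P}"
  have const: "fst h \<in> P \<longleftrightarrow> fst k \<in> P"
    if "P \<in> ?K" "C \<in> components D" "h \<in> C" "k \<in> C" for P C h k
  proof -
    have rel: "(h, k) \<in> gen_rel D {rot, \<alpha>}"
      using that quotient_eq_iff[OF equiv_gen_rel, of C D "{rot, \<alpha>}" C h k]
      by (simp add: components_def gen_classes_eq)
    have inv: "fst (\<alpha> x) \<in> P \<longleftrightarrow> fst x \<in> P" if "x \<in> H" for x
      using vertex_cobound_iff[OF that, of P] \<open>P \<in> ?K\<close> by auto
    have "fst (f x) \<in> P \<longleftrightarrow> fst x \<in> P" if "x \<in> H" "f \<in> {rot, \<alpha>}" for x f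
      using inv[OF that(1)] that(2) by (auto simp: rot_def)
    then show ?thesis
      by (rule gen_rel_invariant[OF rel, where P = "\<lambda>x. fst x \<in> P"])
  qed
  have "inj_on ?f ?K"
  proof
    fix P Q assume P: "P \<in> ?K" and Q: "Q \<in> ?K" and eq: "?f P = ?f Q"
    have "c \<in> P \<longleftrightarrow> c \<in> Q" if "c \<in> crossings D" for c
    proof -
      have h: "(c, 0) \<in> H" using that by (simp add: half_edges_def)
      define C where "C = gen_rel D {rot, \<alpha>} `` {(c, 0)}"
      have C: "C \<in> components D" "(c, 0) \<in> C"
        using h equiv_class_self[OF equiv_gen_rel h]
        unfolding C_def components_def gen_classes_image by blast+
      have "c \<in> R \<longleftrightarrow> C \<in> ?f R" if "R \<in> ?K" for R
      proof -
        have "fst h \<in> R \<longleftrightarrow> c \<in> R" if "h \<in> C" for h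
          using const[OF \<open>R \<in> ?K\<close> C that] by simp
        then show ?thesis using C by blast
      qed
      from this[OF P] this[OF Q] eq show ?thesis by simp
    qed
    then show "P = Q" using P Q by blast
  qed
  moreover have fin: "finite (components D)"
    unfolding components_def by (rule finite_classes)
  ultimately have "card ?K \<le> card (Pow (components D))"
    by (intro card_inj_on_le[of ?f]) auto
  then show ?thesis using fin by (simp add: card_Pow)
qed

lemma edge_cobound_edge:
  assumes "h \<in> H"
  shows "edge_cobound {{h, \<alpha> h}} = sym_diff {face h} {face (\<alpha> h)}"
proof -
  have "odd (card (C \<inter> {h, \<alpha> h})) \<longleftrightarrow> (C = face h) \<noteq> (C = face (\<alpha> h))" if "C \<in> faces D" for C
  proof -
    have "C = face h \<longleftrightarrow> h \<in> C" "C = face (\<alpha> h) \<longleftrightarrow> \<alpha> h \<in> C"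
      using gen_class_eq_iff that assms opp_closed unfolding faces_def by blast+
    moreover have "C \<inter> {h, \<alpha> h} = (if h \<in> C then {h} else {}) \<union> (if \<alpha> h \<in> C then {\<alpha> h} else {})"
      using Collect_doubleton[of h "\<alpha> h" "\<lambda>k. k \<in> C"] by (simp add: Int_def conj_commute)
    ultimately show ?thesis using opp_neq[OF assms] by simp
  qed
  then have "edge_cobound {{h, \<alpha> h}} = {C \<in> faces D. (C = face h) \<noteq> (C = face (\<alpha> h))}"
    unfolding edge_cobound_def by (simp cong: conj_cong)
  moreover have "face h \<in> faces D" "face (\<alpha> h) \<in> faces D"
    using assms opp_closed unfolding faces_def gen_classes_image by blast+
  ultimately show ?thesis by blast
qed

text \<open>A walk from \<open>x\<close> to \<open>y\<close> follows edges and turns at crossings.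
  As \<open>rot h = \<phi> (\<alpha> h)\<close>, the half-edges \<open>rot h\<close> and
  \<open>\<alpha> h\<close> lie in the same face, so both kinds of step have the same effect on
  faces: adding the coboundary of a single edge.\<close>

lemma face_pair_in_image:
  assumes "(x, y) \<in> gen_rel D {rot, \<alpha>}"
  shows "sym_diff {face x} {face y} \<in> edge_cobound ` Pow (edges D)"
proof -
  let ?I = "edge_cobound ` Pow (edges D)"
  have closed: "sym_diff S T \<in> ?I" if ST: "S \<in> ?I" "T \<in> ?I" for S T
  proof -
    obtain g g' where "g \<subseteq> edges D" "S = edge_cobound g" "g' \<subseteq> edges D" "T = edge_cobound g'"
      using ST by auto
    then show ?thesis
      by (intro image_eqI[of _ _ "sym_diff g g'"]) (auto simp: edge_cobound_sym_diff)
  qed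
  have edge: "sym_diff {face h} {face (\<alpha> h)} \<in> ?I" if "h \<in> H" for h
    using that edge_cobound_edge[OF that] by (intro image_eqI[of _ _ "{{h, \<alpha> h}}"]) (auto simp: edges_eq)
  have opp: "sym_diff {face x} {face (\<alpha> h)} \<in> ?I \<longleftrightarrow> sym_diff {face x} {face h} \<in> ?I" if "h \<in> H" for h
  proof -
    have eq: "sym_diff (sym_diff S T) (sym_diff T U) = sym_diff S U"
      "sym_diff (sym_diff S U) (sym_diff T U) = sym_diff S T" for S T U :: "'c half_edge set set"
      by blast+
    show ?thesis
    proof
      assume "sym_diff {face x} {face (\<alpha> h)} \<in> ?I"
      from closed[OF this edge[OF that]] show "sym_diff {face x} {face h} \<in> ?I"
        unfolding eq(2) .
    next
      assume "sym_diff {face x} {face h} \<in> ?I"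
      from closed[OF this edge[OF that]] show "sym_diff {face x} {face (\<alpha> h)} \<in> ?I"
        unfolding eq(1) .
    qed
  qed
  have rot: "face (rot h) = face (\<alpha> h)" if "h \<in> H" for h
  proof -
    have "(\<alpha> h, \<phi> (\<alpha> h)) \<in> gen_rel D {\<phi>}"
      using that by (intro gen_rel_step) (auto simp: opp_closed opp_opp rot_closed)
    from equiv_class_eq[OF equiv_gen_rel this] show ?thesis
      using that by (simp add: opp_opp)
  qed
  have "sym_diff {face x} {face (f h)} \<in> ?I \<longleftrightarrow> sym_diff {face x} {face h} \<in> ?I"
    if h: "h \<in> H" and "f \<in> {rot, \<alpha>}" for h f
  proof -
    consider "f = rot" | "f = \<alpha>" using \<open>f \<in> {rot, \<alpha>}\<close> by blast
    then have "face (f h) = face (\<alpha> h)"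
      by cases (simp_all only: rot[OF h])
    then show ?thesis
      using opp[OF h] by (simp only:)
  qed
  then have "sym_diff {face x} {face x} \<in> ?I \<longleftrightarrow> sym_diff {face x} {face y} \<in> ?I"
    by (rule gen_rel_invariant[OF assms, where P = "\<lambda>z. sym_diff {face x} {face z} \<in> ?I"])
  moreover have "sym_diff {face x} {face x} \<in> ?I"
    by (intro image_eqI[of _ _ "{}"]) (auto simp: edge_cobound_def)
  ultimately show ?thesis by blast
qed

text \<open>Modulo the image, faces that meet along an edge coincide, so one face per component spans the
  cokernel.\<close>

lemma card_edge_image_ge:
  "2 ^ card (faces D) \<le> card (edge_cobound ` Pow (edges D)) * 2 ^ card (components D)"
proof -
  let ?I = "edge_cobound ` Pow (edges D)"
  define rep where "rep C = face (SOME h. h \<in> C)" for C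
  let ?R = "rep ` components D"
  have fin: "finite (faces D)" "finite (components D)"
    unfolding faces_def components_def by (rule finite_classes)+
  have "\<exists>Q\<subseteq>?R. sym_diff S Q \<in> ?I" if "S \<subseteq> faces D" for S
    using finite_subset[OF that fin(1)] that
  proof (induction S rule: finite_induct)
    case empty
    have "{} \<in> ?I" by (intro image_eqI[of _ _ "{}"]) (auto simp: edge_cobound_def)
    then show ?case by (intro exI[of _ "{}"]) simp
  next
    case (insert f S)
    then obtain Q where Q: "Q \<subseteq> ?R" "sym_diff S Q \<in> ?I" by auto
    obtain h where h: "h \<in> H" "f = face h"
      using insert.prems unfolding faces_def gen_classes_image by auto
    define C where "C = gen_rel D {rot, \<alpha>} `` {h}"
    have C: "C \<in> components D" "h \<in> C"
      using h equiv_class_self[OF equiv_gen_rel h(1)]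
      unfolding C_def components_def gen_classes_image by blast+
    from C(2) have "(SOME h. h \<in> C) \<in> C" by (rule someI)
    then have "sym_diff {f} {rep C} \<in> ?I"
      unfolding rep_def h(2) by (intro face_pair_in_image) (simp add: C_def)
    with Q obtain g g' where g: "g \<subseteq> edges D" "sym_diff S Q = edge_cobound g"
        "g' \<subseteq> edges D" "sym_diff {f} {rep C} = edge_cobound g'"
      by auto
    \<comment> \<open>\<open>rep C\<close> is added modulo 2 and not inserted: it may already belong
      to \<open>Q\<close>, and two equal representatives cancel.\<close>
    have "sym_diff (insert f S) (sym_diff Q {rep C}) = sym_diff (sym_diff S Q) (sym_diff {f} {rep C})"
      using insert.hyps by blast
    also have "\<dots> = edge_cobound (sym_diff g g')"
      by (simp add: g edge_cobound_sym_diff)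
    finally have "sym_diff (insert f S) (sym_diff Q {rep C}) \<in> ?I"
      using g by auto
    moreover have "sym_diff Q {rep C} \<subseteq> ?R"
      using Q C by auto
    ultimately show ?case
      by (intro exI[of _ "sym_diff Q {rep C}"] conjI)
  qed
  then have "2 ^ card (faces D) \<le> card ?I * 2 ^ card ?R"
    using fin by (intro card_Pow_le_if_cokernel_spanned) (auto simp: edge_cobound_def)
  also have "\<dots> \<le> card ?I * 2 ^ card (components D)"
    using fin by (intro mult_left_mono power_increasing card_image_le) auto
  finally show ?thesis .
qed

text \<open>Rank-nullity twice. With V, E, F, c the numbers of crossings, edges, faces and
  components, the coboundaries have dimension at least V - c and the cocycles at most E - F + c;
  Euler's formula makes the two bounds equal.\<close>

lemma planar_cocycle_is_coboundary:
  assumes euler: "int (card (crossings D)) - int (card (edges D)) + int (card (faces D))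
       = 2 * int (card (components D))"
    and "g \<subseteq> edges D" and "edge_cobound g = {}"
  obtains P where "g = vertex_cobound P"
proof -
  let ?B = "vertex_cobound ` Pow (crossings D)"
  let ?K = "{P \<in> Pow (crossings D). vertex_cobound P = {}}"
  let ?I = "edge_cobound ` Pow (edges D)"
  let ?Z = "{g \<in> Pow (edges D). edge_cobound g = {}}"
  let ?c = "2 ^ card (components D) :: nat"
  have finE: "finite (edges D)"
    unfolding edges_def by (rule finite_classes)
  have BK: "card ?B * card ?K = 2 ^ card (crossings D)"
    by (rule card_image_times_card_kernel[OF finite_crossings vertex_cobound_sym_diff])
  have IZ: "card ?I * card ?Z = 2 ^ card (edges D)"
    by (rule card_image_times_card_kernel[OF finE edge_cobound_sym_diff])
  have "card (crossings D) + card (faces D) = card (edges D) + 2 * card (components D)"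
    using euler by linarith
  then have exps: "2 ^ card (crossings D) * 2 ^ card (faces D) = 2 ^ card (edges D) * ?c * ?c"
    by (simp flip: power_add add: mult_2)
  \<comment> \<open>Products of cardinalities replace differences of dimensions; the factors
    \<open>?c\<close> and \<open>2 ^ card (faces D)\<close> are carried along on both sides and
    cancel at the end.\<close>
  have "(card ?Z * ?c) * 2 ^ card (faces D) \<le> (card ?Z * ?c) * (card ?I * ?c)"
    by (intro mult_left_mono card_edge_image_ge) simp
  also have "\<dots> = (card ?I * card ?Z) * ?c * ?c"
    by (simp only: ac_simps)
  also have "\<dots> = (card ?B * card ?K) * 2 ^ card (faces D)"
    unfolding IZ BK using exps by simp
  also have "\<dots> \<le> (card ?B * ?c) * 2 ^ card (faces D)"
    by (intro mult_right_mono mult_left_mono card_vertex_kernel_le) simp_all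
  finally have "card ?Z \<le> card ?B" by simp
  moreover have "?B \<subseteq> ?Z"
    using edge_cobound_vertex_cobound by (auto simp: vertex_cobound_def)
  ultimately have "?B = ?Z"
    using finE by (intro card_seteq) auto
  then have "g \<in> ?B"
    using assms(2,3) by simp
  then show thesis
    using that by blast
qed

text \<open>Colouring \<open>h\<close> by the parity of \<open>snd h\<close> alternates around every crossing; it fails to alternate
  along the edges of the cocycle \<open>g\<close>, and exchanging the colours at the crossings in \<open>P\<close> repairs this.\<close>

lemma planar_checkerboard:
  assumes "int (card (crossings D)) - int (card (edges D)) + int (card (faces D))
       = 2 * int (card (components D))"
  obtains P where "\<And>h. h \<in> H \<Longrightarrow>
    (fst (\<alpha> h) \<in> P) = even (snd (\<alpha> h)) \<longleftrightarrow> (fst h \<in> P) \<noteq> even (snd h)"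
proof -
  define g where "g = {e \<in> edges D. \<exists>h\<in>e. even (snd h) = even (snd (\<alpha> h))}"
  have g_iff: "{h, \<alpha> h} \<in> g \<longleftrightarrow> even (snd h) = even (snd (\<alpha> h))" if "h \<in> H" for h
    using that by (auto simp: g_def edges_eq opp_opp)
  have "edge_cobound g = {}"
  proof (rule edge_cobound_eq_empty[of _ "\<lambda>h. even (snd h)"])
    \<comment> \<open>\<open>rot\<close> flips the parity of the position, so differing from
      \<open>\<phi> h\<close> in parity means agreeing with \<open>\<alpha> h\<close>.\<close>
    show "{h, \<alpha> h} \<in> g \<longleftrightarrow> even (snd h) \<noteq> even (snd (\<phi> h))" if "h \<in> H" for h
    proof -
      have "even ((k + 1) mod 4) \<longleftrightarrow> odd k" for k :: nat by presburger
      then show ?thesis using g_iff[OF that] by (simp add: rot_def)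
    qed
  qed (auto simp: g_def)
  moreover have "g \<subseteq> edges D" by (auto simp: g_def)
  ultimately obtain P where P: "g = vertex_cobound P"
    using planar_cocycle_is_coboundary[OF assms] by metis
  show thesis
  proof (rule that)
    show "(fst (\<alpha> h) \<in> P) = even (snd (\<alpha> h)) \<longleftrightarrow> (fst h \<in> P) \<noteq> even (snd h)" if "h \<in> H" for h
      using g_iff[OF that] vertex_cobound_iff[OF that, of P] unfolding P by blast
  qed
qed

end

section \<open>Parity of the number of circles\<close>

lemma half_edge_cases:
  assumes "h \<in> half_edges D"
  obtains c where "c \<in> crossings D" and "h = (c, 0) \<or> h = (c, 1) \<or> h = (c, 2) \<or> h = (c, 3)"
proof -
  have "snd h = 0 \<or> snd h = 1 \<or> snd h = 2 \<or> snd h = 3"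
    using assms by (auto simp: half_edges_def)
  then show thesis
    using assms that[of "fst h"] by (auto simp: half_edges_def prod_eq_iff)
qed

text \<open>The arcs of both splittings join cyclically neighbouring positions, which have opposite
  parity. This is why colours alternate along every arc, whatever the mark.\<close>

lemma smoothing_half_edges:
  assumes "h \<in> half_edges D"
  shows "smoothing s h \<in> half_edges D" and "smoothing s (smoothing s h) = h"
    and "fst (smoothing s h) = fst h" and "even (snd (smoothing s h)) \<longleftrightarrow> odd (snd h)"
proof -
  obtain c where c: "c \<in> crossings D" "h = (c, 0) \<or> h = (c, 1) \<or> h = (c, 2) \<or> h = (c, 3)"
    using assms by (rule half_edge_cases)
  then show "smoothing s h \<in> half_edges D" "smoothing s (smoothing s h) = h"
    "fst (smoothing s h) = fst h" "even (snd (smoothing s h)) \<longleftrightarrow> odd (snd h)"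
    by (cases "s c"; auto simp: smoothing_def half_edges_def)+
qed

text \<open>Changing the splitting makes the two half-edges of one parity exchange their partners:
  0-1 and 2-3 become 0-3 and 2-1. With one parity fixed, only one end of each arc is seen, and the
  change is a single transposition.\<close>

lemma smoothing_B_eq_smoothing_A:
  assumes "s c = A_mark" and "k < 2"
    and "h \<in> half_edges D" and "fst h = c \<longrightarrow> even (snd h) = even k"
  shows "smoothing (s(c := B_mark)) h =
    (if h = (c, k) then smoothing s (c, k + 2) else if h = (c, k + 2) then smoothing s (c, k) else smoothing s h)"
proof -
  obtain d where "h = (d, 0) \<or> h = (d, 1) \<or> h = (d, 2) \<or> h = (d, 3)"
    using assms(3) by (rule half_edge_cases)
  moreover have "k = 0 \<or> k = 1" using assms by auto
  ultimately show ?thesis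
    using assms by (auto simp: smoothing_def)
qed

text \<open>The colour of \<open>h\<close> is the truth value of
  \<open>(fst h \<in> P) \<noteq> even (snd h)\<close>. The left-hand side of the assumption negates
  this for \<open>opp D h\<close>, so every edge exchanges the two colours.\<close>

locale checkerboard_diagram = four_valent_graph D for D :: "'c diagram" +
  fixes P :: "'c set"
  assumes checkerboard: "h \<in> half_edges D \<Longrightarrow>
    (fst (opp D h) \<in> P) = even (snd (opp D h)) \<longleftrightarrow> (fst h \<in> P) \<noteq> even (snd h)"
begin

definition positive :: "'c half_edge set" where
  "positive = {h \<in> half_edges D. (fst h \<in> P) \<noteq> even (snd h)}"

text \<open>The arc and the edge each change the colour, so their composite preserves the colour
  class and advances along the circle by one arc and one edge. Being the identity elsewhere is what
  \<open>permutes\<close> demands.\<close>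

definition turn :: "('c \<Rightarrow> mark) \<Rightarrow> 'c half_edge \<Rightarrow> 'c half_edge" where
  "turn s h = (if h \<in> positive then opp D (smoothing s h) else h)"

lemma positive_subset: "positive \<subseteq> H"
  by (auto simp: positive_def)

lemma finite_positive: "finite positive"
  using finite_H positive_subset by (rule finite_subset[rotated])

lemma opp_positive: "h \<in> H \<Longrightarrow> \<alpha> h \<in> positive \<longleftrightarrow> h \<notin> positive"
  using checkerboard[of h] opp_closed[of h] unfolding positive_def by blast

lemma smoothing_positive: "h \<in> H \<Longrightarrow> smoothing s h \<in> positive \<longleftrightarrow> h \<notin> positive"
  using smoothing_half_edges[of h D s] unfolding positive_def by simp

lemma turn_permutes: "turn s permutes positive"
proof (rule bij_imp_permutes)
  let ?\<tau> = "\<lambda>h. smoothing s (\<alpha> h)"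
  have turn: "turn s h \<in> positive \<and> ?\<tau> (turn s h) = h" if "h \<in> positive" for h
  proof -
    have h: "h \<in> H" using that positive_subset by blast
    note \<sigma> = smoothing_half_edges(1,2)[OF h, of s]
    show ?thesis
      using that opp_positive[OF \<sigma>(1)] opp_opp[OF \<sigma>(1)] smoothing_positive[OF h, of s] \<sigma>(2)
      by (simp add: turn_def)
  qed
  have \<tau>: "?\<tau> h \<in> positive \<and> turn s (?\<tau> h) = h" if "h \<in> positive" for h
  proof -
    have h: "h \<in> H" using that positive_subset by blast
    show ?thesis
      using that opp_positive[OF h] opp_opp[OF h] smoothing_positive[OF opp_closed[OF h], of s]
        smoothing_half_edges(2)[OF opp_closed[OF h], of s]
      by (simp add: turn_def)
  qed
  show "bij_betw (turn s) positive positive"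
    by (rule bij_betw_byWitness[of _ ?\<tau>]) (use turn \<tau> in blast)+
qed (simp add: turn_def)

text \<open>Every circle of a state alternates between positive and other half-edges, and its positive
  half-edges form a single orbit of \<^const>\<open>turn\<close>.\<close>

lemma card_state_classes:
  "card (gen_classes D {\<alpha>, smoothing s}) = card (orbit (turn s) ` positive)"
proof -
  let ?\<sigma> = "smoothing s" and ?R = "gen_rel D {\<alpha>, smoothing s}"
  \<comment> \<open>\<open>r h\<close> is the positive half of the edge of \<open>h\<close>. The
    orbit of \<open>r h\<close> turns out to be a complete invariant of the class of
    \<open>h\<close>, which matches circles with orbits.\<close>
  define r where "r h = (if h \<in> positive then h else \<alpha> h)" for h
  define g where "g h = orbit (turn s) (r h)" for h
  have perm: "permutation (turn s)"
    using finite_positive turn_permutes permutation_permutes by blast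
  note step = permutation_orbit_step[OF perm]
  note \<sigma> = smoothing_half_edges[of _ D s]
  have r_pos: "r h \<in> positive" if "h \<in> H" for h
    using opp_positive[OF that] by (simp add: r_def)
  have r_rel: "(h, r h) \<in> ?R" if "h \<in> H" for h
    using gen_rel_step[OF that, of \<alpha> "{\<alpha>, ?\<sigma>}"] opp_closed[OF that] equiv_gen_rel[of D "{\<alpha>, ?\<sigma>}"] that
    by (simp add: r_def equiv_def refl_on_def)
  have g_opp: "g (\<alpha> h) = g h" if "h \<in> H" for h
    using opp_positive[OF that] opp_opp[OF that] by (simp add: g_def r_def)
  have g_\<sigma>: "g (?\<sigma> h) = g h" if h: "h \<in> H" for h
  proof (cases "h \<in> positive")
    case True
    then have "r (?\<sigma> h) = turn s h" "r h = h"
      using smoothing_positive[OF h, of s] by (simp_all add: r_def turn_def)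
    then show ?thesis using step by (simp add: g_def)
  next
    case False
    then have "r (?\<sigma> h) = ?\<sigma> h" "turn s (?\<sigma> h) = r h"
      using smoothing_positive[OF h, of s] \<sigma>(2)[OF h] by (simp_all add: r_def turn_def)
    then show ?thesis using step[of "?\<sigma> h"] by (simp add: g_def)
  qed
  have g_if_rel: "g x = g y" if "(x, y) \<in> ?R" for x y
  proof -
    have "g (f h) = g x \<longleftrightarrow> g h = g x" if "h \<in> H" "f \<in> {\<alpha>, ?\<sigma>}" for h f
      using that(2) g_opp[OF that(1)] g_\<sigma>[OF that(1)] by auto
    then have "g x = g x \<longleftrightarrow> g y = g x"
      by (rule gen_rel_invariant[OF that, where P = "\<lambda>z. g z = g x"])
    then show ?thesis by simp
  qed
  have turn_rel: "(x, turn s x) \<in> ?R" if x: "x \<in> positive" for x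
  proof -
    have xH: "x \<in> H" using x positive_subset by blast
    have "(x, ?\<sigma> x) \<in> ?R" "(?\<sigma> x, \<alpha> (?\<sigma> x)) \<in> ?R"
      using xH \<sigma>(1)[OF xH] opp_closed[OF \<sigma>(1)[OF xH]] by (auto intro: gen_rel_step)
    then show ?thesis
      using x equiv_gen_rel[of D "{\<alpha>, ?\<sigma>}"] unfolding turn_def by (auto elim: equivE transE)
  qed
  have rel_if_orbit: "(x, y) \<in> ?R \<and> y \<in> positive" if "y \<in> orbit (turn s) x" "x \<in> positive" for x y
    using that
  proof induction
    case base
    then show ?case
      using turn_rel turn_permutes by (simp add: permutes_in_image)
  next
    case (step y)
    then show ?case
      using turn_rel[of y] turn_permutes equiv_gen_rel[of D "{\<alpha>, ?\<sigma>}"]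
      by (auto simp: permutes_in_image elim: equivE transE)
  qed
  have fibres: "?R `` {x} = ?R `` {y} \<longleftrightarrow> g x = g y" if x: "x \<in> H" and y: "y \<in> H" for x y
  proof
    assume "?R `` {x} = ?R `` {y}"
    then have "(x, y) \<in> ?R"
      using eq_equiv_class_iff[OF equiv_gen_rel x y] by blast
    then show "g x = g y" by (rule g_if_rel)
  next
    assume "g x = g y"
    then have "r y \<in> orbit (turn s) (r x)"
      unfolding g_def using orbit_eq_iff[OF perm] by blast
    then have rel: "(r x, r y) \<in> ?R"
      using rel_if_orbit r_pos[OF x] by blast
    note class_eq = equiv_class_eq[OF equiv_gen_rel]
    show "?R `` {x} = ?R `` {y}"
      unfolding class_eq[OF r_rel[OF x]] class_eq[OF r_rel[OF y]] by (rule class_eq[OF rel])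
  qed
  have "g ` H = orbit (turn s) ` positive"
  proof
    show "g ` H \<subseteq> orbit (turn s) ` positive"
      using r_pos unfolding g_def by blast
    have "orbit (turn s) h = g h" if "h \<in> positive" for h
      using that by (simp add: g_def r_def)
    then show "orbit (turn s) ` positive \<subseteq> g ` H"
      using positive_subset by blast
  qed
  moreover have "card ((\<lambda>h. ?R `` {h}) ` H) = card (g ` H)"
    by (rule card_image_eq_if_same_fibres) (rule fibres)
  ultimately show ?thesis
    by (simp only: gen_classes_image)
qed

text \<open>The two permutations differ by a transposition, which reverses the sign whether circles
  merge or split at \<open>c\<close>.\<close>

lemma turn_toggle:
  assumes "c \<in> crossings D" and "s c = A_mark"
  shows "sign (turn (s(c := B_mark))) = - sign (turn s)"
proof -
  \<comment> \<open>The positive half-edges at \<open>c\<close> are those of one parity, odd if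
    \<open>c \<in> P\<close> and even otherwise; they sit at the positions \<open>k\<close> and
    \<open>k + 2\<close>.\<close>
  define k :: nat where "k = (if c \<in> P then 1 else 0)"
  have k: "k < 2" "(c, k) \<in> positive" "(c, k + 2) \<in> positive"
    using assms(1) by (auto simp: k_def positive_def half_edges_def)
  have parity: "fst h = c \<longrightarrow> even (snd h) = even k" if "h \<in> positive" for h
    using that by (auto simp: positive_def k_def)
  have "turn (s(c := B_mark)) = turn s \<circ> transpose (c, k) (c, k + 2)"
  proof
    fix h
    show "turn (s(c := B_mark)) h = (turn s \<circ> transpose (c, k) (c, k + 2)) h"
    proof (cases "h \<in> positive")
      case True
      then have "h \<in> half_edges D" using positive_subset by blast
      from smoothing_B_eq_smoothing_A[of s c k h D, OF assms(2) k(1) this parity[OF True]]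
      show ?thesis
        using True k(2,3) by (simp add: turn_def transpose_def)
    next
      case False
      then have "h \<noteq> (c, k)" "h \<noteq> (c, k + 2)" using k by blast+
      with False show ?thesis by (simp add: turn_def)
    qed
  qed
  moreover have "permutation (turn s)"
    using finite_positive turn_permutes permutation_permutes by blast
  ultimately show ?thesis
    by (simp add: sign_compose permutation_swap_id sign_swap_id)
qed

text \<open>A state is encoded by the set \<open>Q\<close> of its B-marks, so that marks can be
  changed one at a time by induction on \<open>Q\<close>.\<close>

lemma sign_turn:
  assumes "Q \<subseteq> crossings D"
  shows "sign (turn (\<lambda>c\<in>crossings D. if c \<in> Q then B_mark else A_mark)) = (- 1) ^ card Q * sign (turn (state_A D))"
  using finite_subset[OF assms finite_crossings] assms
proof (induction Q rule: finite_induct)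
  case empty
  then show ?case by (simp add: state_A_def)
next
  case (insert c Q)
  let ?s = "\<lambda>Q. \<lambda>c\<in>crossings D. if c \<in> Q then B_mark else A_mark"
  have "?s (insert c Q) = (?s Q)(c := B_mark)"
    using insert.prems by (auto simp: fun_eq_iff)
  moreover have "?s Q c = A_mark"
    using insert by simp
  ultimately have "sign (turn (?s (insert c Q))) = - sign (turn (?s Q))"
    using turn_toggle[of c "?s Q"] insert.prems by simp
  moreover have "sign (turn (?s Q)) = (- 1) ^ card Q * sign (turn (state_A D))"
    using insert by blast
  ultimately show ?case
    using insert.hyps
    by (simp only: card_insert_disjoint power_Suc mult_minus1 mult_minus_left not_False_eq_True)
qed

lemma minus_one_power_circles:
  assumes "s \<in> states D"
  shows "(- 1 :: int) ^ card (circles D s) = (- 1) ^ (b_count D s + card (circles D (state_A D)))"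
proof -
  define Q where "Q = {c \<in> crossings D. s c = B_mark}"
  have s: "s = (\<lambda>c\<in>crossings D. if c \<in> Q then B_mark else A_mark)"
  proof
    fix c
    show "s c = (\<lambda>c\<in>crossings D. if c \<in> Q then B_mark else A_mark) c"
      using assms by (cases "s c") (auto simp: states_def Q_def PiE_def extensional_def)
  qed
  have "sign (turn s) = (- 1) ^ b_count D s * sign (turn (state_A D))"
  proof -
    have "Q \<subseteq> crossings D" "b_count D s = card Q"
      by (auto simp: Q_def b_count_def)
    then show ?thesis
      using sign_turn[of Q] unfolding s[symmetric] by simp
  qed
  \<comment> \<open>The curves without crossings and the number of positive half-edges give signs
    common to all states, so they cancel in the comparison with \<open>state_A D\<close>.\<close>
  moreover have "(- 1 :: int) ^ card (circles D t) = (- 1) ^ loops D * ((- 1) ^ card positive * sign (turn t))" for t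
    using minus_one_power_card_orbits[OF finite_positive turn_permutes, of t]
    by (simp add: circles_def card_Plus finite_classes card_state_classes power_add)
  ultimately show ?thesis
    by (simp add: power_add)
qed

end

section \<open>From parity to the Euler characteristic\<close>

lemma link_diagram_parity:
  assumes "link_diagram D" and "s \<in> states D"
  shows "even (card (circles D s)) \<longleftrightarrow> even (b_count D s + card (circles D (state_A D)))"
proof -
  interpret four_valent_graph D
    using assms(1) unfolding link_diagram_def by unfold_locales blast+
  obtain P where "\<And>h. h \<in> half_edges D \<Longrightarrow>
      (fst (opp D h) \<in> P) = even (snd (opp D h)) \<longleftrightarrow> (fst h \<in> P) \<noteq> even (snd h)"
    using planar_checkerboard assms(1) unfolding link_diagram_def by metis
  then interpret checkerboard_diagram D P
    by unfold_locales
  show ?thesis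
    using minus_one_power_circles[OF assms(2)] by (metis minus_one_power_iff one_neq_neg_one)
qed

text \<open>Guards the truncated subtraction in the exponent \<open>card (circles D s) - 1\<close>
  of the bracket.\<close>

lemma circles_nonempty:
  assumes "nonempty_diagram D"
  shows "circles D s \<noteq> {}"
proof (cases "crossings D = {}")
  case True
  then show ?thesis
    using assms by (auto simp: nonempty_diagram_def circles_def Plus_def)
next
  case False
  then obtain c where "(c, 0) \<in> half_edges D" by (auto simp: half_edges_def)
  then have "gen_classes D {opp D, smoothing s} \<noteq> {}"
    unfolding gen_classes_image by blast
  then show ?thesis by (auto simp: circles_def Plus_def)
qed

theorem theorem3p1:
  fixes D :: "'c diagram"
  assumes "link_diagram D" and "nonempty_diagram D"
  shows "chi_A (bracket_complex D 0) (bracket_complex D 1)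
           = (- A_pow (- 2) - A_pow 2) * kauffman_bracket D"
proof -
  let ?n = "\<lambda>s. b_count D s + card (circles D (state_A D))"
  \<comment> \<open>\<open>z\<close> is the value of a circle in the bracket, while the graded
    dimension of \<open>W\<close> is \<open>- z\<close>. The parity of the number of circles decides
    the sign between the powers of the two.\<close>
  define z where "z = - A_pow 2 - A_pow (- 2)"
  define t where "t s = A_pow (int (a_count D s) - int (b_count D s)) * z ^ card (circles D s)" for s
  have fin: "finite (crossings D)"
    using assms(1) by (simp add: link_diagram_def)
  have z: "A_pow 2 + A_pow (- 2) = - z" "- A_pow (- 2) - A_pow 2 = z"
    by (simp_all add: z_def)
  have q0: "qdim (bracket_complex D 0) = (\<Sum>s | s \<in> states D \<and> ?n s mod 2 = 0. t s)"
    unfolding qdim_bracket_complex[OF fin] t_def z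
  proof (rule sum.cong[OF refl])
    fix s assume "s \<in> {s. s \<in> states D \<and> ?n s mod 2 = 0}"
    then have "even (card (circles D s))"
      using link_diagram_parity[OF assms(1)] by (simp add: even_iff_mod_2_eq_zero)
    then show "A_pow (int (a_count D s) - int (b_count D s)) * (- z) ^ card (circles D s) =
        A_pow (int (a_count D s) - int (b_count D s)) * z ^ card (circles D s)"
      by simp
  qed
  have q1: "qdim (bracket_complex D 1) = - (\<Sum>s | s \<in> states D \<and> ?n s mod 2 = 1. t s)"
    unfolding qdim_bracket_complex[OF fin] t_def z sum_negf[symmetric]
  proof (rule sum.cong[OF refl])
    fix s assume "s \<in> {s. s \<in> states D \<and> ?n s mod 2 = 1}"
    then have "odd (card (circles D s))"
      using link_diagram_parity[OF assms(1), of s] unfolding odd_iff_mod_2_eq_one by auto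
    then show "A_pow (int (a_count D s) - int (b_count D s)) * (- z) ^ card (circles D s) =
        - (A_pow (int (a_count D s) - int (b_count D s)) * z ^ card (circles D s))"
      by simp
  qed
  have "chi_A (bracket_complex D 0) (bracket_complex D 1) =
      (\<Sum>s | s \<in> states D \<and> ?n s mod 2 = 0. t s) + (\<Sum>s | s \<in> states D \<and> ?n s mod 2 = 1. t s)"
    unfolding chi_A_def q0 q1 by (simp only: diff_minus_eq_add)
  also have "\<dots> = (\<Sum>s\<in>{s \<in> states D. ?n s mod 2 = 0} \<union> {s \<in> states D. ?n s mod 2 = 1}. t s)"
    using finite_states[OF fin] by (intro sum.union_disjoint[symmetric]) auto
  also have "{s \<in> states D. ?n s mod 2 = 0} \<union> {s \<in> states D. ?n s mod 2 = 1} = states D"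
    by auto
  also have "(\<Sum>s\<in>states D. t s) = z * kauffman_bracket D"
    unfolding kauffman_bracket_def sum_distrib_left
  proof (rule sum.cong[OF refl])
    fix s
    have "card (circles D s) \<noteq> 0"
      using circles_nonempty[OF assms(2)] finite_circles[OF fin] by simp
    \<comment> \<open>The factor \<open>z\<close> of the unnormalized bracket restores the circle
      that the exponent in the bracket omits.\<close>
    then have "z ^ card (circles D s) = z * z ^ (card (circles D s) - 1)"
      by (metis power_eq_if)
    then show "t s = z * (A_pow (int (a_count D s) - int (b_count D s)) *
        (- A_pow 2 - A_pow (- 2)) ^ (card (circles D s) - 1))"
      by (simp add: t_def z_def mult.left_commute)
  qed
  finally show ?thesis by (simp add: z)
qed

end
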